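(* There is a polynomial-time approximation scheme for the following problem: given a finite set $X$, a distance function $d$ on $X$ of negative type, and two matroids $M_1=(X,\mathcal{I}_1)$, $M_2=(X,\mathcal{I}_2)$ given by independence oracles, find $A\in\mathcal{I}_1\cap\mathcal{I}_2$ maximizing $d(A)$. That is, for every fixed $\epsilon>0$ there is a polynomial-time algorithm returning $A\in\mathcal{I}_1\cap\mathcal{I}_2$ with $d(A)\ge(1-\epsilon)\max\{d(S)\mid S\in\mathcal{I}_1\cap\mathcal{I}_2\}$.
   Context: A distance function on a finite set $X$ is a symmetric function $d:X\times X\to\mathbb{R}_{\ge0}$ with $d(a,a)=0$ for all $a\in X$. It is of negative type if its matrix $D$, $D_{a,b}=d(a,b)$, satisfies $x^TDx\le 0$ for all $x\in\mathbb{R}^X$ with $\sum_a x_a=0$. The dispersion of $A\subseteq X$ is $d(A)=\sum_{\{a,b\}\subseteq A}d(a,b)$ (unordered pairs of distinct elements). *)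

theory Defs
  imports Complex_Main "HOL-Computational_Algebra.Polynomial"
begin

section \<open>Dispersion and matroids\<close>

definition distance_function :: "'a set \<Rightarrow> ('a \<Rightarrow> 'a \<Rightarrow> real) \<Rightarrow> bool" where
  "distance_function X d \<longleftrightarrow>
     (\<forall>a\<in>X. \<forall>b\<in>X. d a b \<ge> 0) \<and>
     (\<forall>a\<in>X. \<forall>b\<in>X. d a b = d b a) \<and>
     (\<forall>a\<in>X. d a a = 0)"

definition negative_type :: "'a set \<Rightarrow> ('a \<Rightarrow> 'a \<Rightarrow> real) \<Rightarrow> bool" where
  "negative_type X d \<longleftrightarrow>
     (\<forall>x :: 'a \<Rightarrow> real. (\<Sum>a\<in>X. x a) = 0 \<longrightarrow> (\<Sum>a\<in>X. \<Sum>b\<in>X. x a * d a b * x b) \<le> 0)"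

text \<open>An unordered pair of distinct elements is represented by its increasing enumeration.\<close>

definition dispersion :: "('a::linorder \<Rightarrow> 'a \<Rightarrow> real) \<Rightarrow> 'a set \<Rightarrow> real" where
  "dispersion d A = (\<Sum>(a, b)\<in>{(a, b). a \<in> A \<and> b \<in> A \<and> a < b}. d a b)"

locale matroid =
  fixes X :: "'a set" and indep :: "'a set set"
  assumes finite_carrier: "finite X"
    and indep_subset: "indep \<subseteq> Pow X"
    and empty_indep: "{} \<in> indep"
    and hereditary: "S \<in> indep \<Longrightarrow> T \<subseteq> S \<Longrightarrow> T \<in> indep"
    and augmentation:
      "S \<in> indep \<Longrightarrow> T \<in> indep \<Longrightarrow> card S < card T \<Longrightarrow> \<exists>x\<in>T - S. insert x S \<in> indep"

section \<open>Oracle programs and their running time\<close>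

text \<open>
  An input consists of the ground set \<open>{..<n}\<close>, the distances, and two families of independent
  sets. Programs are while programs over finitely many unbounded arrays of natural numbers and
  of reals, indexed by computed addresses; all cells are initially 0. A program is a finite
  object: its only literals are natural numbers and integers. It can read \<open>n\<close> and
  single distances, but has access to the two families only through membership queries.

  The only arithmetic is addition and subtraction (truncated on natural numbers). Hence polynomially
  many steps on rational inputs produce only numbers of polynomially many bits, so that a
  polynomial bound on the number of steps yields polynomial time in the bit model as well. With
  unit-cost multiplication (repeated squaring) this would fail.
\<close>

record input =
  elems :: nat
  dist_of :: "nat \<Rightarrow> nat \<Rightarrow> real"
  family1 :: "nat set set"
  family2 :: "nat set set"

type_synonym state = "(nat \<Rightarrow> nat \<Rightarrow> nat) \<times> (nat \<Rightarrow> nat \<Rightarrow> real)"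

datatype nexp =
    NConst nat
  | NSize
  | NArr nat nexp
  | NAdd nexp nexp
  | NSub nexp nexp

datatype rexp =
    RConst int
  | RDist nexp nexp
  | RArr nat nexp
  | RAdd rexp rexp
  | RSub rexp rexp

datatype bexp =
    NLess nexp nexp
  | RLess rexp rexp
  | Indep1 nat
  | Indep2 nat
  | BNot bexp
  | BAnd bexp bexp

datatype com =
    Skip
  | NAssign nat nexp nexp
  | RAssign nat nexp rexp
  | Seq com com
  | Cond bexp com com
  | While bexp com

text \<open>Array number \<open>a\<close>, read as a characteristic vector of a subset of the ground set.\<close>

definition array_set :: "input \<Rightarrow> nat \<Rightarrow> state \<Rightarrow> nat set" where
  "array_set P a s = {i. i < elems P \<and> fst s a i \<noteq> 0}"

fun nval :: "input \<Rightarrow> nexp \<Rightarrow> state \<Rightarrow> nat" where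
  "nval P (NConst k) s = k"
| "nval P NSize s = elems P"
| "nval P (NArr a e) s = fst s a (nval P e s)"
| "nval P (NAdd e f) s = nval P e s + nval P f s"
| "nval P (NSub e f) s = nval P e s - nval P f s"

text \<open>Reading a distance outside the ground set yields 0.\<close>

fun rval :: "input \<Rightarrow> rexp \<Rightarrow> state \<Rightarrow> real" where
  "rval P (RConst k) s = of_int k"
| "rval P (RDist e f) s =
     (if nval P e s < elems P \<and> nval P f s < elems P
      then dist_of P (nval P e s) (nval P f s) else 0)"
| "rval P (RArr a e) s = snd s a (nval P e s)"
| "rval P (RAdd e f) s = rval P e s + rval P f s"
| "rval P (RSub e f) s = rval P e s - rval P f s"

fun bval :: "input \<Rightarrow> bexp \<Rightarrow> state \<Rightarrow> bool" where
  "bval P (NLess e f) s \<longleftrightarrow> nval P e s < nval P f s"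
| "bval P (RLess e f) s \<longleftrightarrow> rval P e s < rval P f s"
| "bval P (Indep1 a) s \<longleftrightarrow> array_set P a s \<in> family1 P"
| "bval P (Indep2 a) s \<longleftrightarrow> array_set P a s \<in> family2 P"
| "bval P (BNot b) s \<longleftrightarrow> \<not> bval P b s"
| "bval P (BAnd b c) s \<longleftrightarrow> bval P b s \<and> bval P c s"

definition nupdate :: "nat \<Rightarrow> nat \<Rightarrow> nat \<Rightarrow> state \<Rightarrow> state" where
  "nupdate a i v s = ((fst s)(a := (fst s a)(i := v)), snd s)"

definition rupdate :: "nat \<Rightarrow> nat \<Rightarrow> real \<Rightarrow> state \<Rightarrow> state" where
  "rupdate a i v s = (fst s, (snd s)(a := (snd s a)(i := v)))"

text \<open>
  \<open>exec P c s t s'\<close>: on input \<open>P\<close>, program \<open>c\<close> started in state \<open>s\<close> terminates in state \<open>s'\<close>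
  after \<open>t\<close> steps. Each assignment and each test, oracle queries included, is one step; the
  expressions of a fixed program have bounded size, so charging for their evaluation would change
  \<open>t\<close> by a constant factor only.
\<close>

inductive exec :: "input \<Rightarrow> com \<Rightarrow> state \<Rightarrow> nat \<Rightarrow> state \<Rightarrow> bool" for P :: input where
  Skip: "exec P Skip s 1 s"
| NAssign: "exec P (NAssign a e f) s 1 (nupdate a (nval P e s) (nval P f s) s)"
| RAssign: "exec P (RAssign a e f) s 1 (rupdate a (nval P e s) (rval P f s) s)"
| Seq: "exec P c s t s' \<Longrightarrow> exec P c' s' t' s'' \<Longrightarrow> exec P (Seq c c') s (t + t') s''"
| CondTrue: "bval P b s \<Longrightarrow> exec P c s t s' \<Longrightarrow> exec P (Cond b c c') s (Suc t) s'"
| CondFalse: "\<not> bval P b s \<Longrightarrow> exec P c' s t s' \<Longrightarrow> exec P (Cond b c c') s (Suc t) s'"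
| WhileFalse: "\<not> bval P b s \<Longrightarrow> exec P (While b c) s 1 s"
| WhileTrue: "bval P b s \<Longrightarrow> exec P c s t s' \<Longrightarrow> exec P (While b c) s' t' s''
    \<Longrightarrow> exec P (While b c) s (Suc (t + t')) s''"

inductive_cases SkipE: "exec P Skip s t s'"
inductive_cases NAssignE: "exec P (NAssign a e f) s t s'"
inductive_cases RAssignE: "exec P (RAssign a e f) s t s'"
inductive_cases SeqE: "exec P (Seq c c') s t s'"
inductive_cases CondE: "exec P (Cond b c c') s t s'"
inductive_cases WhileE: "exec P (While b c) s t s'"

lemma exec_deterministic:
  "exec P c s t s' \<Longrightarrow> exec P c s u r \<Longrightarrow> u = t \<and> r = s'"
proof (induction arbitrary: u r rule: exec.induct)
  case (Seq c s t s' c' t' s'')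
  from Seq.prems show ?case by (rule SeqE) (use Seq.IH in blast)
next
  case (WhileTrue b s c t s' t' s'')
  from WhileTrue.prems show ?case
    by (rule WhileE) (use WhileTrue.hyps WhileTrue.IH in blast)+
qed (unfold One_nat_def, (erule SkipE NAssignE RAssignE CondE WhileE; blast)+)

definition initial_state :: state where
  "initial_state = ((\<lambda>_ _. 0), (\<lambda>_ _. 0))"

text \<open>\<open>returns_within P c t A\<close>: \<open>c\<close> halts on input \<open>P\<close> after at most \<open>t\<close> steps with \<open>A\<close> in array 0.\<close>

definition returns_within :: "input \<Rightarrow> com \<Rightarrow> nat \<Rightarrow> nat set \<Rightarrow> bool" where
  "returns_within P c t A \<longleftrightarrow>
     (\<exists>u s. exec P c initial_state u s \<and> u \<le> t \<and> array_set P 0 s = A)"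

end

theory Submission
  imports Defs "HOL-Combinatorics.Transposition"
begin

text \<open>
  The algorithm is local search: in each round, replace the current set by the best common independent
  set that differs from it in at most \<open>q\<close> elements, where \<open>q\<close> depends only on \<open>\<epsilon>\<close>.

  Let \<open>A\<close> be the current set and \<open>B\<close> an optimal one. Matchings in the exchange graphs of the two
  matroids decompose the symmetric difference, after padding with free elements, into cycles. A smallest cycle of at least average
  density has no harmful chords, so each of its segments with \<open>p\<close> elements of \<open>B\<close> and \<open>p + 1\<close> elements
  of \<open>A\<close> is a feasible exchange. For linear weights, one of these exchanges therefore
  gains a polynomial fraction of the weight of \<open>B\<close> minus \<open>1 + 1/p\<close> times the weight of \<open>A\<close>. The weight
  of an element is its distance sum to \<open>A\<close>, corrected by a bound on the second-order terms:
  thinking of \<open>d\<close> as a squared Euclidean distance, \<open>d(u, v)\<close> is at most three times the sum of the squared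
  distances of \<open>u\<close> and \<open>v\<close> from the centroids of their sets and of the two centroids from each other.
  Negative type bounds the distance sum between \<open>A\<close> and \<open>B\<close> from below, and the
  corrections are negligible once \<open>A\<close> is large. If \<open>A\<close> is small, or small compared to
  \<open>B\<close>, a few changes suffice for simpler reasons. So the distance to almost optimal dispersion
  shrinks in each round by a factor \<open>1 - 1/(2n^3)\<close>, and polynomially many rounds suffice.
\<close>

section \<open>Exchanges in two matroids\<close>

context matroid
begin

lemma finite_indep: "S \<in> indep \<Longrightarrow> finite S"
  using finite_carrier indep_subset finite_subset by blast

lemma extend_indep:
  assumes "S \<in> indep" "T \<in> indep" "card S \<le> card T"
  obtains W where "W \<in> indep" "S \<subseteq> W" "W \<subseteq> S \<union> T" "card W = card T"
proof -
  have "\<exists>W\<in>indep. S \<subseteq> W \<and> W \<subseteq> S \<union> T \<and> card W = card T"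
    using assms
  proof (induction "card T - card S" arbitrary: S)
    case 0
    then show ?case by (intro bexI[of _ S]) auto
  next
    case (Suc k)
    then have "card S < card T" by linarith
    with Suc.prems obtain x where x: "x \<in> T - S" "insert x S \<in> indep"
      using augmentation by blast
    then have "card (insert x S) = Suc (card S)"
      using finite_indep[OF Suc.prems(1)] by simp
    with Suc.hyps x(2) \<open>card S < card T\<close> Suc.prems(2)
    have "\<exists>W\<in>indep. insert x S \<subseteq> W \<and> W \<subseteq> insert x S \<union> T \<and> card W = card T"
      by (intro Suc.hyps(1)) auto
    then show ?case using x(1) by blast
  qed
  then show ?thesis using that by blast
qed

text \<open>Sets of equal size behave like bases of a truncation. If \<open>insert a B\<close> is
  dependent, \<open>b\<close> is sought in the circuit that \<open>a\<close> closes in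
  \<open>B\<close>. If no element of it could replace \<open>a\<close> in \<open>A\<close>, then
  \<open>A - {a}\<close> would be a largest independent subset of \<open>A - {a} \<union> Z\<close>,
  and augmenting a set containing \<open>Z\<close> from \<open>A\<close> would make the circuit
  independent.\<close>

lemma symmetric_exchange:
  assumes A: "A \<in> indep" and B: "B \<in> indep" and card: "card A = card B" and a: "a \<in> A - B"
  obtains b where "b \<in> B - A" "insert b (A - {a}) \<in> indep" "insert a (B - {b}) \<in> indep"
proof (cases "insert a B \<in> indep")
  case True
  have "card (A - {a}) < card B"
    using a card card_Diff1_less[OF finite_indep[OF A], of a] by simp
  moreover have "A - {a} \<in> indep" by (rule hereditary[OF A]) auto
  ultimately obtain b where b: "b \<in> B - (A - {a})" "insert b (A - {a}) \<in> indep"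
    using augmentation[OF _ B] by blast
  moreover have "insert a (B - {b}) \<in> indep" by (rule hereditary[OF True]) auto
  ultimately show ?thesis using a that by blast
next
  case False
  \<comment> \<open>\<open>insert a Z\<close> is the fundamental circuit of \<open>a\<close> with
    respect to \<open>B\<close>.\<close>
  define Z where "Z = {b \<in> B. insert a (B - {b}) \<in> indep}"
  have finA: "finite A" and finB: "finite B" using A B finite_indep by auto
  have Aa: "A - {a} \<in> indep" by (rule hereditary[OF A]) auto
  have Zind: "Z \<in> indep" by (rule hereditary[OF B]) (auto simp: Z_def)
  have ZaN: "insert a Z \<notin> indep"
  proof
    assume Za: "insert a Z \<in> indep"
    have "Z \<noteq> B" using Za False by auto
    then have "card Z < card B" using finB by (intro psubset_card_mono) (auto simp: Z_def)
    then have "card (insert a Z) \<le> card B"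
      using finite_indep[OF Zind] by (simp add: card_insert_if)
    \<comment> \<open>The set \<open>W\<close> has to omit exactly one \<open>b\<close> of
      \<open>B\<close>. Then \<open>b\<close> belongs to \<open>Z\<close> by definition, although
      \<open>Z \<subseteq> W\<close>.\<close>
    then obtain W where W: "W \<in> indep" "insert a Z \<subseteq> W" "W \<subseteq> insert a Z \<union> B" "card W = card B"
      using extend_indep[OF Za B] by blast
    have WB: "W \<subseteq> insert a B" using W(3) by (auto simp: Z_def)
    have "W \<noteq> insert a B" using W(1) False by blast
    then obtain b where b: "b \<in> B" "b \<notin> W" using WB W(2) by blast
    have "W = insert a (B - {b})"
    proof (rule card_subset_eq)
      show "card W = card (insert a (B - {b}))"
        using W(4) a card.remove[OF finB b(1)] finB by simp
    qed (use WB b finB in auto)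
    then have "b \<in> Z" using W(1) b by (auto simp: Z_def)
    then show False using W(2) b by blast
  qed
  have "\<exists>b\<in>Z. b \<notin> A \<and> insert b (A - {a}) \<in> indep"
  proof (rule ccontr)
    assume no: "\<not> ?thesis"
    \<comment> \<open>A set as large as \<open>A\<close> would augment \<open>A - {a}\<close> by an
      element of \<open>Z\<close>, which \<open>no\<close> excludes.\<close>
    have small: "card S < card A" if S: "S \<in> indep" "S \<subseteq> (A - {a}) \<union> Z" for S
    proof (rule ccontr)
      assume "\<not> ?thesis"
      then have "card (A - {a}) < card S"
        using a card_Diff1_less[OF finA, of a] by auto
      then obtain x where "x \<in> S - (A - {a})" "insert x (A - {a}) \<in> indep"
        using augmentation[OF Aa S(1)] by blast
      then show False using no S(2) a unfolding Z_def by blast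
    qed
    have "card Z < card A" using small Zind by blast
    then have "card Z \<le> card (A - {a})" using a by (simp add: card_Diff_singleton)
    then obtain W where W: "W \<in> indep" "Z \<subseteq> W" "W \<subseteq> Z \<union> (A - {a})" "card W = card (A - {a})"
      using extend_indep[OF Zind Aa] by blast
    then have "card W < card A" using a card_Diff1_less[OF finA, of a] by simp
    then obtain x where x: "x \<in> A - W" "insert x W \<in> indep"
      using augmentation[OF W(1) A] by blast
    show False
    proof (cases "x = a")
      case True
      then show False using W(2) ZaN hereditary[OF x(2), of "insert a Z"] by auto
    next
      case False
      then have "card (insert x W) < card A" using x W(3) by (intro small) auto
      moreover have "card (insert x W) = card A"
        using x W(4) a finite_indep[OF W(1)] finA
        by (simp add: card_Suc_Diff1 del: card_Diff_insert)
      ultimately show False by simp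
    qed
  qed
  then show ?thesis using that unfolding Z_def by blast
qed

text \<open>A symmetric exchange pairs some \<open>b\<close> with some \<open>a\<close>. It also
  keeps \<open>B - {b} \<union> {a}\<close> independent and of the same size, but closer to
  \<open>A\<close>, so the other pairs come from the induction hypothesis for that set.\<close>

lemma exchange_bijection:
  assumes "A \<in> indep" "B \<in> indep" "card A = card B"
  shows "\<exists>f. bij_betw f (B - A) (A - B) \<and> (\<forall>b\<in>B - A. insert b (A - {f b}) \<in> indep)"
  using assms
proof (induction "card (A - B)" arbitrary: B)
  case 0
  then have "A \<subseteq> B" using finite_indep[of A] by auto
  then have "A = B" using 0 finite_indep by (meson card_subset_eq)
  then show ?case by (auto simp: bij_betw_def)
next
  case (Suc k)
  have finA: "finite A" and finB: "finite B" using Suc.prems finite_indep by auto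
  obtain a where a: "a \<in> A - B"
    using Suc.hyps(2) by (metis card.empty ex_in_conv nat.distinct(1))
  obtain b where b: "b \<in> B - A" "insert b (A - {a}) \<in> indep" "insert a (B - {b}) \<in> indep"
    using symmetric_exchange[OF Suc.prems a] by blast
  let ?B = "insert a (B - {b})"
  have "card ?B = card B" using a b finB by (simp add: card_Suc_Diff1 del: card_Diff_insert)
  moreover have AB: "A - ?B = A - B - {a}" and BA: "?B - A = B - A - {b}" using a b by auto
  then have "card (A - ?B) = k" using Suc.hyps(2) a finA by simp
  ultimately obtain f where f: "bij_betw f (B - A - {b}) (A - B - {a})"
    "\<forall>x\<in>B - A - {b}. insert x (A - {f x}) \<in> indep"
    using Suc.hyps(1)[of ?B] Suc.prems b(3) unfolding AB BA by auto
  have "bij_betw (f(b := a)) (B - A - {b}) (A - B - {a})"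
    using f(1) by (rule bij_betw_cong[THEN iffD1, rotated]) auto
  then have "bij_betw (f(b := a)) (B - A - {b} \<union> {b}) (A - B - {a} \<union> {a})"
    using notIn_Un_bij_betw[of b "B - A - {b}" "f(b := a)" "A - B - {a}"] by simp
  then have "bij_betw (f(b := a)) (B - A) (A - B)"
    using a b by (simp add: insert_absorb)
  then show ?case using f(2) b(2) by (intro exI[of _ "f(b := a)"]) auto
qed

text \<open>
  The keys make the exchange relation between \<open>J\<close> and \<open>u ` J\<close> triangular, so that the exchanges can be
  carried out one after the other.
\<close>

lemma exchange_by_keys:
  fixes key :: "'a \<Rightarrow> real"
  assumes A: "A \<in> indep" and "finite J" and "J \<inter> A = {}" and "inj_on u J" and "u ` J \<subseteq> A"
    and "\<And>x. x \<in> J \<Longrightarrow> insert x (A - {u x}) \<in> indep"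
    and "\<And>x y. x \<in> J \<Longrightarrow> y \<in> J \<Longrightarrow> x \<noteq> y \<Longrightarrow> insert x (A - {u y}) \<in> indep \<Longrightarrow> key x < key y"
  shows "A - u ` J \<union> J \<in> indep"
  using assms(2-)
\<comment> \<open>Elements are added by decreasing key. So \<open>m\<close> has the least key, and
  no element \<open>x\<close> of \<open>S\<close> can replace \<open>u m\<close> in
  \<open>A\<close>.\<close>
proof (induction J rule: finite_ranking_induct[where f = "\<lambda>x. - key x"])
  case empty
  then show ?case using A by simp
next
  case (insert m S)
  show ?case
  proof (cases "m \<in> S")
    case True
    then show ?thesis using insert.IH insert.prems by (simp add: insert_absorb)
  next
    case m: False
    have finA: "finite A" using A finite_indep by blast
    define B where "B = A - u ` S \<union> S"
    have B: "B \<in> indep"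
      unfolding B_def by (rule insert.IH) (use insert.prems in auto)
    have uS: "u ` S \<subseteq> A" "u m \<in> A" "u m \<notin> u ` S" "S \<inter> A = {}" "m \<notin> A"
      using insert.prems insert.hyps m by auto
    have cardB: "card B = card A"
    proof -
      have "inj_on u S" using insert.prems by simp
      then have "card (A - u ` S) = card A - card S" and "card S \<le> card A"
        using uS insert.hyps finA by (auto simp: card_Diff_subset card_image intro: card_inj_on_le)
      then show ?thesis
        unfolding B_def using uS insert.hyps finA by (subst card_Un_disjoint) auto
    qed
    have um: "u m \<in> B" using uS by (auto simp: B_def)
    have B': "B - {u m} \<in> indep" by (rule hereditary[OF B]) auto
    have Au: "A - {u m} \<in> indep" by (rule hereditary[OF A]) auto
    have Am: "insert m (A - {u m}) \<in> indep" using insert.prems by simp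
    have cardAm: "card (insert m (A - {u m})) = card A" using uS card.remove[OF finA, of "u m"] finA by simp
    have no: "insert x (A - {u m}) \<notin> indep" if "x \<in> S" for x
    proof
      assume "insert x (A - {u m}) \<in> indep"
      then have "key x < key m" using that m by (intro insert.prems(5)) auto
      then show False using insert.hyps(2)[OF that] by simp
    qed
    have cardB': "card (B - {u m}) < card A" using card_Diff1_less[OF finite_indep[OF B] um] cardB by simp
    then obtain x where x: "x \<in> insert m (A - {u m}) - (B - {u m})" "insert x (B - {u m}) \<in> indep"
      using augmentation[OF B' Am] cardAm by auto
    \<comment> \<open>Any other \<open>x\<close> lies in \<open>A\<close>. Then
      \<open>insert x (B - {u m})\<close> is larger than \<open>A - {u m}\<close> and could augment
      it only by an element of \<open>S\<close>, contradicting \<open>no\<close>.\<close>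
    have "x = m"
    proof (rule ccontr)
      assume "x \<noteq> m"
      then have xA: "x \<in> A - {u m}" using x by blast
      have "card (insert x (B - {u m})) = card A"
        using x card.remove[OF finite_indep[OF B] um] cardB finite_indep[OF B] by simp
      then have "card (A - {u m}) < card (insert x (B - {u m}))"
        using card_Diff1_less[OF finA uS(2)] by simp
      then obtain y where y: "y \<in> insert x (B - {u m}) - (A - {u m})" "insert y (A - {u m}) \<in> indep"
        using augmentation[OF Au x(2)] by blast
      then have "y \<in> S" using xA by (auto simp: B_def)
      then show False using no y(2) by blast
    qed
    moreover have "insert m (B - {u m}) = A - u ` insert m S \<union> insert m S"
      using uS by (auto simp: B_def)
    ultimately show ?thesis using x(2) by simp
  qed
qed

end

section \<open>Cycles in the exchange graphs of two matroids\<close>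

text \<open>Two matchings of \<open>S\<close> onto one common set, whose union is a disjoint union
  of alternating cycles. \<open>E1\<close> and \<open>E2\<close> will stand for the single swaps
  that the two matroids allow.\<close>

definition exchange_system ::
    "('a \<Rightarrow> 'b \<Rightarrow> bool) \<Rightarrow> ('a \<Rightarrow> 'b \<Rightarrow> bool) \<Rightarrow> 'a set \<Rightarrow> ('a \<Rightarrow> 'b) \<Rightarrow> ('a \<Rightarrow> 'b) \<Rightarrow> bool" where
  "exchange_system E1 E2 S f1 f2 \<longleftrightarrow>
     inj_on f1 S \<and> inj_on f2 S \<and> f1 ` S = f2 ` S \<and> (\<forall>x\<in>S. E1 x (f1 x) \<and> E2 x (f2 x))"

lemma exchange_system_swap: "exchange_system E1 E2 S f1 f2 \<longleftrightarrow> exchange_system E2 E1 S f2 f1"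
  unfolding exchange_system_def by auto

text \<open>Going forward along \<open>f1\<close> and back along \<open>f2\<close> permutes
  \<open>S\<close>; the orbits of \<open>\<pi>\<close> are the cycles.\<close>

lemma exchange_system_rotation:
  assumes "exchange_system E1 E2 S f1 f2"
  obtains \<pi> where "bij_betw \<pi> S S" "\<And>x. x \<in> S \<Longrightarrow> f2 (\<pi> x) = f1 x"
proof
  have b: "bij_betw f1 S (f1 ` S)" "bij_betw f2 S (f1 ` S)"
    using assms unfolding exchange_system_def bij_betw_def by auto
  show "bij_betw (inv_into S f2 \<circ> f1) S S"
    using bij_betw_trans[OF b(1) bij_betw_inv_into[OF b(2)]] .
  show "f2 ((inv_into S f2 \<circ> f1) x) = f1 x" if "x \<in> S" for x
    using that b by (auto simp: bij_betw_def f_inv_into_f)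
qed

text \<open>
  A minimal system is a single cycle. A chord \<open>E1 x (f1 y)\<close> shortcuts it to a smaller system, which has
  negative weight. Hence the partial sums of \<open>g\<close> along the cycle are larger at \<open>y\<close> than at \<open>x\<close>.
\<close>

lemma minimal_exchange_system:
  fixes g :: "'a \<Rightarrow> real"
  assumes fin: "finite S" and x0: "x0 \<in> S" and sys: "exchange_system E1 E2 S f1 f2"
    and nonneg: "0 \<le> sum g S"
    and minimal: "\<And>S' f1'. S' \<subset> S \<Longrightarrow> S' \<noteq> {} \<Longrightarrow> exchange_system E1 E2 S' f1' f2 \<Longrightarrow> sum g S' < 0"
    and bij: "bij_betw \<pi> S S" and \<pi>: "\<And>x. x \<in> S \<Longrightarrow> f2 (\<pi> x) = f1 x"
  shows "bij_betw (\<lambda>i. (\<pi> ^^ i) x0) {..<card S} S"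
    and "\<exists>key :: 'a \<Rightarrow> real. \<forall>x\<in>S. \<forall>y\<in>S. x \<noteq> y \<longrightarrow> E1 x (f1 y) \<longrightarrow> key x < key y"
proof -
  define v where "v i = (\<pi> ^^ i) x0" for i
  have inj: "inj_on \<pi> S" and im: "\<pi> ` S = S" using bij by (auto simp: bij_betw_def)
  have vS: "v i \<in> S" for i
    unfolding v_def by (induction i) (use x0 im in auto)
  have v_Suc: "v (Suc i) = \<pi> (v i)" for i by (simp add: v_def)
  have f2v: "f2 (v (Suc i)) = f1 (v i)" for i using \<pi> vS v_Suc by metis
  have sub: "exchange_system E1 E2 Z f1 f2" if "Z \<subseteq> S" "\<pi> ` Z = Z" for Z
  proof -
    have "f1 ` Z = f2 ` \<pi> ` Z" using that(1) \<pi> by (force simp: image_image)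
    then show ?thesis
      using sys that unfolding exchange_system_def by (auto intro: inj_on_subset)
  qed
  \<comment> \<open>Otherwise the orbit of \<open>x0\<close> and its complement are both smaller
    systems. Both have negative weight, although the total is nonnegative.\<close>
  have range: "range v = S"
  proof (rule ccontr)
    assume neq: "range v \<noteq> S"
    have sub1: "range v \<subset> S" using neq vS by blast
    have "\<pi> ` range v \<subseteq> range v" by (auto simp flip: v_Suc)
    moreover have "finite (range v)" using sub1 fin finite_subset by blast
    moreover have "inj_on \<pi> (range v)" using inj sub1 by (meson inj_on_subset psubset_imp_subset)
    ultimately have inv: "\<pi> ` range v = range v" by (simp add: endo_inj_surj)
    have neg: "sum g (range v) < 0"
      by (rule minimal[OF sub1 _ sub[OF _ inv]]) (use sub1 in auto)
    have "\<pi> ` (S - range v) = S - range v"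
      using inj_on_image_set_diff[OF inj, of S "range v"] inv im sub1 by auto
    moreover have "S - range v \<subset> S" using vS[of 0] by blast
    ultimately have "sum g (S - range v) < 0"
      using sub1 by (intro minimal[OF _ _ sub]) auto
    moreover have "sum g S = sum g (S - range v) + sum g (range v)"
      using sub1 fin by (intro sum.subset_diff) auto
    ultimately show False using nonneg neg by linarith
  qed
  have cancel: "v (j - i) = x0" if "i \<le> j" "v i = v j" for i j
    using that
  proof (induction i arbitrary: j)
    case (Suc i)
    then obtain j' where j: "j = Suc j'" by (cases j) auto
    then have "v i = v j'" using Suc.prems vS inj v_Suc by (metis inj_onD)
    then show ?case using Suc j by simp
  qed (simp add: v_def)
  have injv: "inj_on v {..<card S}"
  proof (rule linorder_inj_onI)
    fix i j assume ij: "i < j" "i \<in> {..<card S}" "j \<in> {..<card S}"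
    show "v i \<noteq> v j"
    proof
      assume "v i = v j"
      \<comment> \<open>The sequence would have period \<open>j - i < card S\<close>, too short to
        visit all of \<open>S\<close>.\<close>
      then have "(\<pi> ^^ (j - i)) x0 = x0" using cancel[of i j] ij by (simp add: v_def)
      then have per: "v m = v (m mod (j - i))" for m
        unfolding v_def by (rule funpow_mod_eq[symmetric])
      have "v m \<in> v ` {..<j - i}" for m
        by (subst per) (use ij in auto)
      then have "range v \<subseteq> v ` {..<j - i}" by blast
      then have "card S \<le> card (v ` {..<j - i})" using range by (simp add: card_mono)
      also have "\<dots> \<le> j - i" using card_image_le[of "{..<j - i}" v] by simp
      finally show False using ij by simp
    qed
  qed auto
  have imv: "v ` {..<card S} = S"
    using vS injv fin by (intro card_subset_eq) (auto simp: card_image)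
  show "bij_betw (\<lambda>i. (\<pi> ^^ i) x0) {..<card S} S"
    using injv imv by (simp add: bij_betw_def v_def[abs_def])
  define idx where "idx = inv_into {..<card S} v"
  have idx: "idx x < card S" "v (idx x) = x" if "x \<in> S" for x
    using that imv inv_into_into[of x v "{..<card S}"] f_inv_into_f[of x v "{..<card S}"]
    by (auto simp: idx_def)
  define key where "key x = (\<Sum>l\<le>idx x. g (v l))" for x
  \<comment> \<open>Exchanging the \<open>f1\<close>-partners of \<open>v a\<close> and
    \<open>v b\<close> closes the arc at positions \<open>a + 1\<close> to \<open>b\<close> into a
    cycle of its own, because \<open>f1 (v t) = f2 (v (Suc t))\<close>.\<close>
  have closed: "(f1 \<circ> transpose (v a) (v b)) ` v ` {a<..b} = f2 ` v ` {a<..b}"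
    if ab: "a < b" "b < card S" for a b
  proof -
    have "{a<..b} = insert b {a<..<b}" using ab(1) by auto
    then have "v ` {a<..b} = insert (v b) (v ` {a<..<b})" by simp
    moreover have "(f1 \<circ> transpose (v a) (v b)) ` v ` {a<..<b} = (\<lambda>t. f1 (v t)) ` {a<..<b}"
      unfolding image_image
    proof (rule image_cong)
      fix t assume t: "t \<in> {a<..<b}"
      have "v t \<noteq> v a" "v t \<noteq> v b" using inj_on_eq_iff[OF injv] ab t by auto
      then show "(f1 \<circ> transpose (v a) (v b)) (v t) = f1 (v t)" by simp
    qed simp
    ultimately have "(f1 \<circ> transpose (v a) (v b)) ` v ` {a<..b} = insert (f1 (v a)) ((\<lambda>t. f1 (v t)) ` {a<..<b})"
      by simp
    also have "\<dots> = (\<lambda>t. f2 (v (Suc t))) ` {a..<b}"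
    proof -
      have "{a..<b} = insert a {a<..<b}" using ab by auto
      then show ?thesis by (simp add: f2v)
    qed
    also have "\<dots> = (\<lambda>t. f2 (v t)) ` Suc ` {a..<b}" by (simp only: image_image)
    also have "Suc ` {a..<b} = {a<..b}" by (auto simp: image_Suc_atLeastLessThan)
    finally show ?thesis by (simp add: image_image)
  qed
  have "key x < key y" if x: "x \<in> S" and y: "y \<in> S" and neq: "x \<noteq> y" and E: "E1 x (f1 y)" for x y
  proof -
    define a b where "a = min (idx x) (idx y)" and "b = max (idx x) (idx y)"
    have ne: "idx x \<noteq> idx y" using idx x y neq by metis
    then have ab: "a < b" "b < card S" using idx x y by (auto simp: a_def b_def)
    define R where "R = v ` {a<..b}"
    define h where "h = f1 \<circ> transpose x y"
    have h: "h = f1 \<circ> transpose (v a) (v b)"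
      using idx x y by (auto simp: h_def a_def b_def min_def max_def transpose_commute)
    have hR: "h ` R = f2 ` R" using closed[OF ab] unfolding h R_def .
    have "v a \<noteq> v t" if "t \<in> {a<..b}" for t
      using inj_on_eq_iff[OF injv, of a t] ab that by auto
    then have aR: "v a \<notin> R" unfolding R_def by blast
    have bR: "v b \<in> R" using ab by (auto simp: R_def)
    have RS: "R \<subset> S" "R \<noteq> {}"
      using vS aR bR unfolding R_def by blast+
    have trS: "transpose x y ` S = S" using x y by (simp add: transpose_image_eq)
    have "inj_on f1 S" "f1 ` S = f2 ` S" "inj_on f2 S" using sys by (auto simp: exchange_system_def)
    then have injh: "inj_on h S" and hS: "h ` S = f2 ` S"
      unfolding h_def by (simp_all only: trS image_comp[symmetric] comp_inj_on inj_on_transpose)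
    \<comment> \<open>The chord justifies \<open>h x = f1 y\<close>. Nothing is known about
      \<open>h y = f1 x\<close>, so \<open>y\<close> has to stay outside \<open>Z\<close>.\<close>
    have sys': "exchange_system E1 E2 Z h f2" if Z: "Z \<subseteq> S" "h ` Z = f2 ` Z" "y \<notin> Z" for Z
    proof -
      have "E1 z (h z)" if "z \<in> Z" for z
        using that Z E sys by (cases "z = x") (auto simp: h_def exchange_system_def transpose_def)
      then show ?thesis
        using sys injh Z unfolding exchange_system_def by (auto intro: inj_on_subset)
    qed
    have sumR: "(\<Sum>l\<le>b. g (v l)) = (\<Sum>l\<le>a. g (v l)) + sum g R"
    proof -
      have "{..b} = {..a} \<union> {a<..b}" using ab by auto
      then have "(\<Sum>l\<le>b. g (v l)) = (\<Sum>l\<le>a. g (v l)) + (\<Sum>l\<in>{a<..b}. g (v l))"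
        by (simp only:) (subst sum.union_disjoint, auto)
      moreover have "inj_on v {a<..b}" using ab by (intro inj_on_subset[OF injv]) auto
      ultimately show ?thesis by (simp add: R_def sum.reindex)
    qed
    show ?thesis
    proof (cases "idx x < idx y")
      \<comment> \<open>Here \<open>x\<close> comes first, and the chord closes the complement of
        the arc \<open>R\<close>. The complement avoids \<open>y\<close>, so its weight is negative
        and that of \<open>R\<close> is positive.\<close>
      case True
      then have ab_eq: "a = idx x" "b = idx y" by (auto simp: a_def b_def)
      have "h ` (S - R) = f2 ` (S - R)"
        using inj_on_image_set_diff[OF injh, of S R] inj_on_image_set_diff[of f2 S S R] RS hS hR sys
        by (auto simp: exchange_system_def)
      moreover have "y \<in> R" "x \<in> S - R" using aR bR ab_eq idx x y by auto
      ultimately have "sum g (S - R) < 0" using RS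
        by (intro minimal[OF _ _ sys']) auto
      moreover have "sum g S = sum g (S - R) + sum g R"
        using RS fin by (intro sum.subset_diff) auto
      ultimately have "sum g R > 0" using nonneg by linarith
      then show ?thesis using sumR by (simp add: key_def ab_eq)
    next
      \<comment> \<open>Here \<open>y\<close> comes first, and the chord closes \<open>R\<close>
        itself, which therefore has negative weight.\<close>
      case False
      then have ab_eq: "a = idx y" "b = idx x" using ne by (auto simp: a_def b_def)
      then have "y \<notin> R" using aR idx y by auto
      then have "sum g R < 0" using RS hR by (intro minimal[OF _ _ sys']) auto
      then show ?thesis using sumR by (simp add: key_def ab_eq)
    qed
  qed
  then show "\<exists>key :: 'a \<Rightarrow> real. \<forall>x\<in>S. \<forall>y\<in>S. x \<noteq> y \<longrightarrow> E1 x (f1 y) \<longrightarrow> key x < key y" by blast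
qed

text \<open>A smallest nonempty subsystem reaching the average value \<open>\<rho>\<close> per
  element is a single cycle, with keys for both matroids. Average over all starting points of
  segments of \<open>p\<close> consecutive elements: their partners fill at most
  \<open>p + 1\<close> consecutive positions, so each \<open>w\<close> is counted \<open>p\<close>
  times and each \<open>c\<close> at most \<open>p + 1\<close> times. This ratio is the factor
  \<open>1 + 1 / p\<close>.\<close>

lemma exchange_segment:
  fixes w :: "'a \<Rightarrow> real" and c :: "'b \<Rightarrow> real" and p :: nat
  assumes finV: "finite V" and V: "V \<noteq> {}" and sysV: "exchange_system E1 E2 V g1 g2"
    and c: "\<forall>x u. E1 x u \<longrightarrow> 0 \<le> c u" and p: "0 < p"
    and total: "0 \<le> sum w V - (1 + 1 / p) * sum c (g1 ` V)"
  shows "\<exists>T h1 h2 key1 key2. T \<subseteq> V \<and> card T \<le> p \<and> card (h1 ` T \<union> h2 ` T) \<le> p + 1 \<and>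
    inj_on h1 T \<and> inj_on h2 T \<and> (\<forall>x\<in>T. E1 x (h1 x) \<and> E2 x (h2 x)) \<and>
    (\<forall>x\<in>T. \<forall>y\<in>T. x \<noteq> y \<longrightarrow> E1 x (h1 y) \<longrightarrow> key1 x < (key1 y :: real)) \<and>
    (\<forall>x\<in>T. \<forall>y\<in>T. x \<noteq> y \<longrightarrow> E2 x (h2 y) \<longrightarrow> key2 x < (key2 y :: real)) \<and>
    sum w V - (1 + 1 / p) * sum c (g1 ` V) \<le> card V * (sum w T - sum c (h1 ` T \<union> h2 ` T))"
proof -
  define \<theta> where "\<theta> = 1 + 1 / real p"
  define val where "val S f = sum w S - \<theta> * sum c (f ` S)" for S and f :: "'a \<Rightarrow> 'b"
  define \<rho> where "\<rho> = val V g1 / card V"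
  have cardV: "0 < card V" using V finV by (simp add: card_gt_0_iff)
  have \<rho>0: "0 \<le> \<rho>" using total by (simp add: \<rho>_def val_def \<theta>_def)
  define good where "good S f1 f2 \<longleftrightarrow> S \<subseteq> V \<and> S \<noteq> {} \<and> exchange_system E1 E2 S f1 f2 \<and> \<rho> * card S \<le> val S f1"
    for S f1 f2
  define k where "k = (LEAST k. \<exists>S f1 f2. good S f1 f2 \<and> card S = k)"
  have "good V g1 g2" using V sysV cardV by (simp add: good_def \<rho>_def)
  then obtain S f1 f2 where good: "good S f1 f2" and "card S = k"
    using LeastI_ex[of "\<lambda>k. \<exists>S f1 f2. good S f1 f2 \<and> card S = k"] unfolding k_def by blast
  then have least: "card S \<le> card S'" if "good S' f1' f2'" for S' f1' f2'
    using that Least_le[of "\<lambda>k. \<exists>S f1 f2. good S f1 f2 \<and> card S = k" "card S'"] unfolding k_def by auto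
  have S: "S \<subseteq> V" "S \<noteq> {}" and sys: "exchange_system E1 E2 S f1 f2" and valS: "\<rho> * card S \<le> val S f1"
    using good by (auto simp: good_def)
  have finS: "finite S" using S finV finite_subset by blast
  have cardS: "0 < card S" using S finS by (simp add: card_gt_0_iff)
  obtain x0 where x0: "x0 \<in> S" using S(2) by blast
  have small: "val S' f1' < \<rho> * card S'"
    if "S' \<subset> S" "S' \<noteq> {}" "exchange_system E1 E2 S' f1' f2'" for S' f1' f2'
  proof (rule ccontr)
    assume "\<not> ?thesis"
    then have "good S' f1' f2'" using that S by (auto simp: good_def)
    then have "card S \<le> card S'" by (rule least)
    then show False using psubset_card_mono[OF finS that(1)] by simp
  qed
  \<comment> \<open>With \<open>\<rho>\<close> subtracted from each element, being below average
    means having negative weight, as \<open>minimal_exchange_system\<close> requires.\<close>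
  define G where "G f x = w x - \<theta> * c (f x) - \<rho>" for f :: "'a \<Rightarrow> 'b" and x
  have G: "sum (G f) Z = val Z f - \<rho> * card Z" if "inj_on f Z" for f Z
    using that by (simp add: G_def val_def sum_subtractf sum_distrib_left sum.reindex o_def)
  have val_swap: "val Z f2' = val Z f1'" if "exchange_system E1 E2 Z f1' f2'" for Z f1' f2'
    using that by (simp add: val_def exchange_system_def)
  obtain \<pi> where \<pi>: "bij_betw \<pi> S S" "\<And>x. x \<in> S \<Longrightarrow> f2 (\<pi> x) = f1 x"
    using exchange_system_rotation[OF sys] by blast
  have sys2: "exchange_system E2 E1 S f2 f1" using sys exchange_system_swap by blast
  obtain \<pi>2 where \<pi>2: "bij_betw \<pi>2 S S" "\<And>x. x \<in> S \<Longrightarrow> f1 (\<pi>2 x) = f2 x"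
    using exchange_system_rotation[OF sys2] by blast
  have nonneg: "0 \<le> sum (G f2) S" "0 \<le> sum (G f1) S"
    using sys valS val_swap[OF sys] by (auto simp: G exchange_system_def)
  \<comment> \<open>The weight refers to the matching that stays fixed while the other one varies.
    Both have the same image, so \<open>val\<close> is the same for either.\<close>
  have min1: "sum (G f2) S' < 0" if "S' \<subset> S" "S' \<noteq> {}" "exchange_system E1 E2 S' f1' f2" for S' f1'
    using small[OF that] val_swap[OF that(3)] that(3) by (simp add: G exchange_system_def)
  have min2: "sum (G f1) S' < 0" if "S' \<subset> S" "S' \<noteq> {}" "exchange_system E2 E1 S' f2' f1" for S' f2'
  proof -
    have "exchange_system E1 E2 S' f1 f2'" using that(3) exchange_system_swap by blast
    from small[OF that(1,2) this] this show ?thesis by (simp add: G exchange_system_def)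
  qed
  have ex1: "\<exists>key :: 'a \<Rightarrow> real. \<forall>x\<in>S. \<forall>y\<in>S. x \<noteq> y \<longrightarrow> E1 x (f1 y) \<longrightarrow> key x < key y"
    by (rule minimal_exchange_system(2)[OF finS x0 sys nonneg(1) _ \<pi>]) (rule min1)
  have ex2: "\<exists>key :: 'a \<Rightarrow> real. \<forall>x\<in>S. \<forall>y\<in>S. x \<noteq> y \<longrightarrow> E2 x (f2 y) \<longrightarrow> key x < key y"
    by (rule minimal_exchange_system(2)[OF finS x0 sys2 nonneg(2) _ \<pi>2]) (rule min2)
  obtain key1 :: "'a \<Rightarrow> real" where key1: "\<forall>x\<in>S. \<forall>y\<in>S. x \<noteq> y \<longrightarrow> E1 x (f1 y) \<longrightarrow> key1 x < key1 y"
    using ex1 by auto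
  obtain key2 :: "'a \<Rightarrow> real" where key2: "\<forall>x\<in>S. \<forall>y\<in>S. x \<noteq> y \<longrightarrow> E2 x (f2 y) \<longrightarrow> key2 x < key2 y"
    using ex2 by auto
  have cyc: "bij_betw (\<lambda>i. (\<pi> ^^ i) x) {..<card S} S" if "x \<in> S" for x
    by (rule minimal_exchange_system(1)[OF finS that sys nonneg(1) _ \<pi>]) (rule min1)
  have c2: "0 \<le> c (f2 x)" if "x \<in> S" for x
  proof -
    have "f2 x \<in> f1 ` S" using sys that by (auto simp: exchange_system_def)
    then obtain y where y: "y \<in> S" "f2 x = f1 y" by auto
    then have "E1 y (f1 y)" using sys by (simp add: exchange_system_def)
    from c[rule_format, OF this] show ?thesis using y by simp
  qed
  have sumc: "sum c (f1 ` S) = (\<Sum>x\<in>S. c (f2 x))"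
    using sys by (simp add: exchange_system_def sum.reindex)
  have valS': "\<rho> \<le> val S f1"
  proof -
    have "1 \<le> real (card S)" using cardS by simp
    then have "\<rho> * 1 \<le> \<rho> * card S" using \<rho>0 by (intro mult_left_mono)
    then show ?thesis using valS by simp
  qed
  have target: "sum w V - (1 + 1 / p) * sum c (g1 ` V) = card V * \<rho>"
    using cardV by (simp add: \<rho>_def val_def \<theta>_def)
  have sysD: "inj_on f1 S" "inj_on f2 S" "\<forall>x\<in>S. E1 x (f1 x) \<and> E2 x (f2 x)" "f1 ` S = f2 ` S"
    using sys by (auto simp: exchange_system_def)
  have ex: "\<exists>T\<subseteq>S. card T \<le> p \<and> card (f1 ` T \<union> f2 ` T) \<le> p + 1 \<and>
      \<rho> \<le> sum w T - sum c (f1 ` T \<union> f2 ` T)"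
  proof (cases "card S \<le> p")
    \<comment> \<open>A cycle with at most \<open>p\<close> elements is exchanged as a
      whole.\<close>
    case True
    have "0 \<le> sum c (f1 ` S)" using c2 sumc by (simp add: sum_nonneg)
    then have "sum c (f1 ` S) \<le> \<theta> * sum c (f1 ` S)" by (simp add: \<theta>_def algebra_simps)
    then have "\<rho> \<le> sum w S - sum c (f1 ` S)" using valS' by (simp add: val_def)
    moreover have "f1 ` S \<union> f2 ` S = f1 ` S" using sysD by simp
    moreover have "card (f1 ` S) \<le> p + 1" using True sysD by (simp add: card_image)
    ultimately show ?thesis using True by (intro exI[of _ S]) auto
  next
    case False
    define v where "v x t = (\<pi> ^^ t) x" for x t
    have vS: "v x t \<in> S" if "x \<in> S" for x t
      unfolding v_def by (induction t) (use that \<pi>(1) in \<open>auto simp: bij_betw_def\<close>)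
    have bij_t: "bij_betw (\<lambda>x. v x t) S S" for t
    proof (induction t)
      case (Suc t)
      then show ?case using bij_betw_trans[OF Suc \<pi>(1)] by (simp add: v_def o_def)
    qed (simp add: v_def bij_betw_def)
    define T where "T x = v x ` {..<p}" for x
    have inj_v: "inj_on (v x) {..<p}" if "x \<in> S" for x
      using cyc[OF that] False by (auto simp: bij_betw_def v_def[abs_def] intro: inj_on_subset)
    have f12: "f1 ` T x \<union> f2 ` T x \<subseteq> (\<lambda>t. f2 (v x t)) ` {..p}" if "x \<in> S" for x
    proof -
      have "f1 (v x t) = f2 (v x (Suc t))" for t
        using \<pi>(2)[OF vS[OF that, of t]] by (simp add: v_def)
      then show ?thesis using p by (auto simp: T_def image_iff Bex_def intro: Suc_leI)
    qed
    have cT: "sum c (f1 ` T x \<union> f2 ` T x) \<le> (\<Sum>t\<le>p. c (f2 (v x t)))" if "x \<in> S" for x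
    proof -
      have "sum c (f1 ` T x \<union> f2 ` T x) \<le> sum c ((\<lambda>t. f2 (v x t)) ` {..p})"
        using f12[OF that] c2 vS[OF that] by (intro sum_mono2) auto
      also have "\<dots> \<le> (\<Sum>t\<le>p. c (f2 (v x t)))"
        using c2 vS[OF that] by (intro sum_image_le[THEN order_trans]) auto
      finally show ?thesis .
    qed
    have wT: "sum w (T x) = (\<Sum>t<p. w (v x t))" if "x \<in> S" for x
      using inj_v[OF that] by (simp add: T_def sum.reindex)
    have sum_shift: "(\<Sum>x\<in>S. h (v x t)) = sum h S" for h :: "'a \<Rightarrow> real" and t
      using sum.reindex_bij_betw[OF bij_t] .
    \<comment> \<open>The chain starting here bounds the total gain of the segments over all
      starting points \<open>x\<close> from below, so one segment gains at least
      \<open>\<rho>\<close>.\<close>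
    have "(\<Sum>x\<in>S. \<rho>) \<le> p * val S f1"
    proof -
      have "\<rho> * card S \<le> val S f1" using valS .
      also have "\<dots> \<le> p * val S f1" using p valS' \<rho>0 by (simp add: mult_le_cancel_right1)
      finally show ?thesis by (simp add: mult.commute)
    qed
    also have "\<dots> = p * sum w S - (p + 1) * (\<Sum>x\<in>S. c (f2 x))"
      using p by (simp add: val_def \<theta>_def sumc field_simps)
    also have "\<dots> = (\<Sum>t<p. \<Sum>x\<in>S. w (v x t)) - (\<Sum>t\<le>p. \<Sum>x\<in>S. c (f2 (v x t)))"
      using sum_shift[of w] sum_shift[of "\<lambda>x. c (f2 x)"] by simp
    also have "\<dots> = (\<Sum>x\<in>S. (\<Sum>t<p. w (v x t)) - (\<Sum>t\<le>p. c (f2 (v x t))))"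
      by (simp add: sum_subtractf sum.swap[of _ S])
    also have "\<dots> \<le> (\<Sum>x\<in>S. sum w (T x) - sum c (f1 ` T x \<union> f2 ` T x))"
      using cT wT by (intro sum_mono) fastforce
    finally obtain x where x: "x \<in> S" "\<rho> \<le> sum w (T x) - sum c (f1 ` T x \<union> f2 ` T x)"
      using S(2) finS sum_strict_mono[of S "\<lambda>x. sum w (T x) - sum c (f1 ` T x \<union> f2 ` T x)" "\<lambda>x. \<rho>"]
      by (meson not_less)
    have "T x \<subseteq> S" using vS x by (auto simp: T_def)
    moreover have "card (T x) \<le> p" unfolding T_def using card_image_le[of "{..<p}"] by (metis card_lessThan finite_lessThan)
    moreover have "card (f1 ` T x \<union> f2 ` T x) \<le> card ((\<lambda>t. f2 (v x t)) ` {..p})"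
      using f12[OF x(1)] by (intro card_mono) auto
    then have "card (f1 ` T x \<union> f2 ` T x) \<le> p + 1"
      using card_image_le[of "{..p}" "\<lambda>t. f2 (v x t)"] by simp
    ultimately show ?thesis using x by blast
  qed
  then obtain T where T: "T \<subseteq> S" "card T \<le> p" "card (f1 ` T \<union> f2 ` T) \<le> p + 1"
    "\<rho> \<le> sum w T - sum c (f1 ` T \<union> f2 ` T)" by blast
  have "card V * \<rho> \<le> card V * (sum w T - sum c (f1 ` T \<union> f2 ` T))"
    using T(4) by (intro mult_left_mono) auto
  moreover have "\<forall>x\<in>T. \<forall>y\<in>T. x \<noteq> y \<longrightarrow> E1 x (f1 y) \<longrightarrow> key1 x < key1 y"
    using key1 subsetD[OF T(1)] by simp
  moreover have "\<forall>x\<in>T. \<forall>y\<in>T. x \<noteq> y \<longrightarrow> E2 x (f2 y) \<longrightarrow> key2 x < key2 y"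
    using key2 subsetD[OF T(1)] by simp
  moreover have "\<forall>x\<in>T. E1 x (f1 x) \<and> E2 x (f2 x)"
    using sysD(3) subsetD[OF T(1)] by simp
  moreover have "T \<subseteq> V" using T(1) S(1) by simp
  ultimately show ?thesis
    unfolding target using T(2,3) inj_on_subset[OF sysD(1) T(1)] inj_on_subset[OF sysD(2) T(1)]
    by (intro exI[of _ T] exI[of _ f1] exI[of _ f2] exI[of _ key1] exI[of _ key2] conjI)
qed

lemma common_exchange_equicardinal:
  fixes w c :: "'a \<Rightarrow> real" and p :: nat
  assumes m1: "matroid X I1" and m2: "matroid X I2"
    and A: "A \<in> I1 \<inter> I2" and B: "B \<in> I1 \<inter> I2" and card: "card A = card B"
    and c: "\<And>x. x \<in> A \<Longrightarrow> 0 \<le> c x" and p: "0 < p"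
    and nonneg: "0 \<le> sum w (B - A) - (1 + 1 / p) * sum c (A - B)"
  shows "\<exists>U V. U \<subseteq> A \<and> V \<subseteq> B - A \<and> card V \<le> p \<and> card U \<le> p + 1 \<and> A - U \<union> V \<in> I1 \<inter> I2 \<and>
    sum w (B - A) - (1 + 1 / p) * sum c (A - B) \<le> card (B - A) * (sum w V - sum c U)"
proof (cases "B - A = {}")
  case True
  have "finite A" using A matroid.finite_indep[OF m1] by blast
  then have "A = B" using True card by (metis Diff_eq_empty_iff card_subset_eq)
  then show ?thesis using A by (intro exI[of _ "{}"]) auto
next
  case False
  define E where "E I x u \<longleftrightarrow> u \<in> A \<and> insert x (A - {u}) \<in> I" for I and x u :: 'a
  obtain g1 where g1: "bij_betw g1 (B - A) (A - B)" "\<forall>b\<in>B - A. insert b (A - {g1 b}) \<in> I1"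
    using matroid.exchange_bijection[OF m1 _ _ card] A B by blast
  obtain g2 where g2: "bij_betw g2 (B - A) (A - B)" "\<forall>b\<in>B - A. insert b (A - {g2 b}) \<in> I2"
    using matroid.exchange_bijection[OF m2 _ _ card] A B by blast
  have sys: "exchange_system (E I1) (E I2) (B - A) g1 g2"
    using g1 g2 by (auto simp: exchange_system_def E_def bij_betw_def)
  have im: "g1 ` (B - A) = A - B" using g1(1) by (simp add: bij_betw_def)
  have finBA: "finite (B - A)" using B matroid.finite_indep[OF m1] by auto
  have cE: "\<forall>x u. E I1 x u \<longrightarrow> 0 \<le> c u" using c by (simp add: E_def)
  obtain T h1 h2 and key1 key2 :: "'a \<Rightarrow> real" where T: "T \<subseteq> B - A" "card T \<le> p"
      "card (h1 ` T \<union> h2 ` T) \<le> p + 1" "inj_on h1 T" "inj_on h2 T"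
      "\<forall>x\<in>T. E I1 x (h1 x) \<and> E I2 x (h2 x)"
      "\<forall>x\<in>T. \<forall>y\<in>T. x \<noteq> y \<longrightarrow> E I1 x (h1 y) \<longrightarrow> key1 x < key1 y"
      "\<forall>x\<in>T. \<forall>y\<in>T. x \<noteq> y \<longrightarrow> E I2 x (h2 y) \<longrightarrow> key2 x < key2 y"
      "sum w (B - A) - (1 + 1 / p) * sum c (A - B)
        \<le> card (B - A) * (sum w T - sum c (h1 ` T \<union> h2 ` T))"
    using exchange_segment[OF finBA False sys cE p, unfolded im, OF nonneg]
    by (elim exE conjE) (rule that; assumption)
  have finT: "finite T" using T(1) finBA finite_subset by blast
  have h: "h1 x \<in> A" "insert x (A - {h1 x}) \<in> I1" "h2 x \<in> A" "insert x (A - {h2 x}) \<in> I2"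
    if "x \<in> T" for x using T(6) that by (auto simp: E_def)
  have "A - h1 ` T \<union> T \<in> I1"
    by (rule matroid.exchange_by_keys[OF m1, of A T h1 key1])
      (use A T(1,4,7) h finT in \<open>auto simp: E_def\<close>)
  moreover have "A - h2 ` T \<union> T \<in> I2"
    by (rule matroid.exchange_by_keys[OF m2, of A T h2 key2])
      (use A T(1,5,8) h finT in \<open>auto simp: E_def\<close>)
  moreover have "A - (h1 ` T \<union> h2 ` T) \<union> T \<subseteq> A - h1 ` T \<union> T"
    "A - (h1 ` T \<union> h2 ` T) \<union> T \<subseteq> A - h2 ` T \<union> T" by auto
  ultimately have "A - (h1 ` T \<union> h2 ` T) \<union> T \<in> I1 \<inter> I2"
    using matroid.hereditary[OF m1] matroid.hereditary[OF m2] by (meson IntI)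
  moreover have "h1 ` T \<union> h2 ` T \<subseteq> A" using h by auto
  ultimately show ?thesis using T(1-3,9) by blast
qed

section \<open>Sets of different sizes\<close>

text \<open>
  Adding free elements and truncating at rank \<open>k\<close> lets both sets be padded to the common
  cardinality \<open>k\<close>.
\<close>

lemma matroid_padding:
  assumes "matroid X I"
  shows "matroid (Inl ` X \<union> Inr ` {..<k}) {S. finite S \<and> S \<subseteq> Inl ` X \<union> Inr ` {..<k} \<and> Inl -` S \<in> I \<and> card S \<le> k}"
    (is "matroid ?X ?I")
proof -
  interpret matroid X I by fact
  have split: "card S = card (Inl -` S) + card (Inr -` S)"
    if "finite S" for S :: "('a + nat) set"
  proof -
    have "S = Inl ` (Inl -` S) \<union> Inr ` (Inr -` S)"
      by (auto simp: image_iff) (metis sum.exhaust)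
    then have "card S = card (Inl ` (Inl -` S) \<union> Inr ` (Inr -` S) :: ('a + nat) set)" by (rule arg_cong)
    also have "\<dots> = card (Inl ` (Inl -` S) :: ('a + nat) set) + card (Inr ` (Inr -` S) :: ('a + nat) set)"
      using that by (intro card_Un_disjoint) auto
    finally show ?thesis by (simp only: card_image inj_Inl inj_Inr)
  qed
  show ?thesis
  proof
    show "finite ?X" using finite_carrier by simp
    show "?I \<subseteq> Pow ?X" by blast
    show "{} \<in> ?I" using empty_indep by simp
    show "T \<in> ?I" if "S \<in> ?I" "T \<subseteq> S" for S T
    proof -
      have "card T \<le> card S" using that by (intro card_mono) auto
      moreover have "Inl -` S \<in> I" using that(1) by simp
      then have "Inl -` T \<in> I" by (rule hereditary) (use that(2) in blast)
      moreover have "finite T" using that(1) finite_subset[OF that(2)] by simp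
      moreover have "T \<subseteq> ?X" using that(1) by (intro subset_trans[OF that(2)]) simp
      ultimately show ?thesis using that(1) by simp
    qed
    show "\<exists>x\<in>T - S. insert x S \<in> ?I" if S: "S \<in> ?I" and T: "T \<in> ?I" and card: "card S < card T" for S T
    \<comment> \<open>A free element of \<open>T\<close> missing in \<open>S\<close> can always be
      added. If there is none, \<open>T\<close> has more original elements than \<open>S\<close>,
      and \<open>I\<close> provides the augmentation.\<close>
    proof (cases "Inr -` T \<subseteq> Inr -` S")
      case True
      have "finite (Inr -` S)" using S by (auto intro: finite_vimageI)
      then have "card (Inr -` T) \<le> card (Inr -` S)" using True by (rule card_mono)
      then have "card (Inl -` S) < card (Inl -` T)" using card S T split[of S] split[of T] by simp
      then obtain x where x: "x \<in> Inl -` T - Inl -` S" "insert x (Inl -` S) \<in> I"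
        using augmentation[of "Inl -` S" "Inl -` T"] S T by auto
      moreover have "Inl -` insert (Inl x) S = insert x (Inl -` S)" by auto
      moreover have "card (insert (Inl x) S) \<le> k" using S T card by (auto simp: card_insert_if)
      ultimately show ?thesis using S T by (intro bexI[of _ "Inl x"]) auto
    next
      case False
      then obtain i where i: "Inr i \<in> T - S" by auto
      moreover have "Inl -` insert (Inr i) S = Inl -` S" by auto
      moreover have "card (insert (Inr i) S) \<le> k" using S T card by (auto simp: card_insert_if)
      ultimately show ?thesis using S T by (intro bexI[of _ "Inr i"]) auto
    qed
  qed
qed

text \<open>Both sets are padded to size \<open>k\<close> with free elements of weight 0. Discarding
  the free elements from the exchange changes no weight and can only make \<open>U\<close> and
  \<open>V\<close> smaller. The factor \<open>card X\<close> comes from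
  \<open>k \<le> card X\<close>.\<close>

lemma common_exchange:
  fixes w c :: "'a \<Rightarrow> real" and p :: nat
  assumes m1: "matroid X I1" and m2: "matroid X I2"
    and A: "A \<in> I1 \<inter> I2" and B: "B \<in> I1 \<inter> I2"
    and c: "\<forall>x\<in>A. 0 \<le> c x" and p: "0 < p"
    and nonneg: "0 \<le> sum w (B - A) - (1 + 1 / p) * sum c (A - B)"
  shows "\<exists>U V. U \<subseteq> A \<and> V \<subseteq> B - A \<and> card V \<le> p \<and> card U \<le> p + 1 \<and> A - U \<union> V \<in> I1 \<inter> I2 \<and>
    sum w (B - A) - (1 + 1 / p) * sum c (A - B) \<le> card X * (sum w V - sum c U)"
\<comment> \<open>The zero case is split off because strict positivity will show that the gain is
  nonnegative, which allows enlarging its factor to \<open>card X\<close>.\<close>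
proof (cases "sum w (B - A) - (1 + 1 / p) * sum c (A - B) = 0")
  case True
  then show ?thesis using A by (intro exI[of _ "{}"]) auto
next
  case False
  then have pos: "0 < sum w (B - A) - (1 + 1 / p) * sum c (A - B)" using nonneg by linarith
  define k where "k = max (card A) (card B)"
  define pad where "pad S = Inl ` S \<union> Inr ` {..<k - card S}" for S :: "'a set"
  define J where "J I = {S. finite S \<and> S \<subseteq> Inl ` X \<union> Inr ` {..<k} \<and> Inl -` S \<in> I \<and> card S \<le> k}"
    for I :: "'a set set"
  define w' c' :: "'a + nat \<Rightarrow> real" where "w' = case_sum w (\<lambda>_. 0)" and "c' = case_sum c (\<lambda>_. 0)"
  have fin: "finite A" "finite B" using A B matroid.finite_indep[OF m1] by auto
  have AX: "A \<subseteq> X" "B \<subseteq> X" using A B matroid.indep_subset[OF m1] by auto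
  have kX: "k \<le> card X"
    using AX matroid.finite_carrier[OF m1] by (simp add: k_def card_mono)
  have card_pad: "card (pad S) = k" if "finite S" "card S \<le> k" for S
    using that unfolding pad_def by (subst card_Un_disjoint) (auto simp: card_image)
  have vpad: "Inl -` pad S = S" for S by (auto simp: pad_def)
  have padJ: "pad S \<in> J I" if "finite S" "card S \<le> k" "S \<subseteq> X" "S \<in> I" for S I
    unfolding J_def mem_Collect_eq vpad card_pad[OF that(1,2)] using that by (auto simp: pad_def)
  have mJ: "matroid (Inl ` X \<union> Inr ` {..<k}) (J I1)" "matroid (Inl ` X \<union> Inr ` {..<k}) (J I2)"
    unfolding J_def using matroid_padding m1 m2 by blast+
  have sum_real: "sum (case_sum f (\<lambda>_. 0)) S = sum f (Inl -` S)" if "finite S"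
    for f :: "'a \<Rightarrow> real" and S :: "('a + nat) set"
  proof -
    have "sum (case_sum f (\<lambda>_. 0)) S = sum (case_sum f (\<lambda>_. 0)) (Inl ` (Inl -` S) :: ('a + nat) set)"
      by (rule sum.mono_neutral_right[OF that]) (auto split: sum.splits)
    then show ?thesis by (simp add: sum.reindex o_def del: image_vimage_eq)
  qed
  have vdiff: "Inl -` (pad S - pad T) = S - T" for S T by (auto simp: pad_def)
  have finpad: "finite (pad S)" if "finite S" for S using that by (simp add: pad_def)
  have totals: "sum w' (pad B - pad A) = sum w (B - A)" "sum c' (pad A - pad B) = sum c (A - B)"
    unfolding w'_def c'_def using fin by (simp_all add: sum_real finpad vdiff)
  have le: "card A \<le> k" "card B \<le> k" by (auto simp: k_def)
  have c': "0 \<le> c' x" if "x \<in> pad A" for x using that c by (auto simp: c'_def pad_def)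
  have "pad A \<in> J I1 \<inter> J I2" "pad B \<in> J I1 \<inter> J I2" using padJ fin le AX A B by auto
  then obtain U V where UV: "U \<subseteq> pad A" "V \<subseteq> pad B - pad A" "card V \<le> p" "card U \<le> p + 1"
    "pad A - U \<union> V \<in> J I1 \<inter> J I2"
    "sum w (B - A) - (1 + 1 / p) * sum c (A - B) \<le> card (pad B - pad A) * (sum w' V - sum c' U)"
    using common_exchange_equicardinal[OF mJ, of "pad A" "pad B" c' p w'] c' p nonneg
      card_pad fin le unfolding totals by auto
  have finUV: "finite U" "finite V" using UV(1,2) finpad fin by (meson finite_subset finite_Diff)+
  have card_v: "card (Inl -` S) \<le> card S" if "finite S" for S :: "('a + nat) set"
  proof -
    have "card (Inl -` S) = card (Inl ` (Inl -` S) :: ('a + nat) set)"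
      by (simp only: card_image inj_Inl)
    also have "\<dots> \<le> card S" using that by (intro card_mono) auto
    finally show ?thesis .
  qed
  have "0 < card (pad B - pad A) * (sum w' V - sum c' U)" using UV(6) pos by linarith
  then have "0 \<le> sum w' V - sum c' U" by (simp add: zero_less_mult_iff)
  moreover have "card (pad B - pad A) \<le> card (pad B)" using finpad fin by (intro card_mono) auto
  then have "real (card (pad B - pad A)) \<le> card X" using card_pad[OF fin(2) le(2)] kX by simp
  ultimately have "card (pad B - pad A) * (sum w' V - sum c' U) \<le> card X * (sum w' V - sum c' U)"
    by (intro mult_right_mono)
  then have "sum w (B - A) - (1 + 1 / p) * sum c (A - B) \<le> card X * (sum w' V - sum c' U)"
    using UV(6) by linarith
  moreover have "Inl -` (pad A - U \<union> V) = A - Inl -` U \<union> Inl -` V" using vpad[of A] by auto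
  then have "A - Inl -` U \<union> Inl -` V \<in> I1 \<inter> I2" using UV(5) by (auto simp: J_def)
  moreover have "Inl -` U \<subseteq> A" "Inl -` V \<subseteq> B - A" using UV(1,2) vpad[of A] vdiff[of B A] by blast+
  ultimately show ?thesis
    using UV(3,4) card_v[OF finUV(1)] card_v[OF finUV(2)] finUV
    by (intro exI[of _ "Inl -` U"] exI[of _ "Inl -` V"]) (auto simp: w'_def c'_def sum_real)
qed

section \<open>Dispersion in spaces of negative type\<close>

locale negative_type_space =
  fixes X :: "'a::linorder set" and d :: "'a \<Rightarrow> 'a \<Rightarrow> real"
  assumes finite_points: "finite X"
    and distance: "distance_function X d"
    and negative: "negative_type X d"
begin

lemma d_nonneg: "a \<in> X \<Longrightarrow> b \<in> X \<Longrightarrow> 0 \<le> d a b"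
  and d_sym: "a \<in> X \<Longrightarrow> b \<in> X \<Longrightarrow> d a b = d b a"
  and d_refl: "a \<in> X \<Longrightarrow> d a a = 0"
  using distance by (auto simp: distance_function_def)

section \<open>The distance matrix as a bilinear form\<close>

definition form :: "('a \<Rightarrow> real) \<Rightarrow> ('a \<Rightarrow> real) \<Rightarrow> real" where
  "form x y = (\<Sum>a\<in>X. \<Sum>b\<in>X. x a * d a b * y b)"

definition cross :: "'a set \<Rightarrow> 'a set \<Rightarrow> real" where
  "cross S T = (\<Sum>a\<in>S. \<Sum>b\<in>T. d a b)"

lemma form_add_left: "form (\<lambda>a. x a + x' a) y = form x y + form x' y"
  and form_diff_left: "form (\<lambda>a. x a - x' a) y = form x y - form x' y"
  and form_scale_left: "form (\<lambda>a. r * x a) y = r * form x y"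
  by (simp_all add: form_def algebra_simps sum.distrib sum_subtractf sum_distrib_left)

lemma form_commute: "form x y = form y x"
  unfolding form_def by (subst sum.swap) (auto intro!: sum.cong simp: d_sym)

lemma form_add_right: "form y (\<lambda>a. x a + x' a) = form y x + form y x'"
  and form_diff_right: "form y (\<lambda>a. x a - x' a) = form y x - form y x'"
  and form_scale_right: "form y (\<lambda>a. r * x a) = r * form y x"
  by (simp_all only: form_commute[of y] form_add_left form_diff_left form_scale_left)

lemmas form_bilinear = form_add_left form_diff_left form_scale_left
  form_add_right form_diff_right form_scale_right

lemma form_nonpos: "sum x X = 0 \<Longrightarrow> form x x \<le> 0"
  using negative by (simp add: negative_type_def form_def)

lemma form_indicator:
  assumes "S \<subseteq> X" "T \<subseteq> X"
  shows "form (\<lambda>a. of_bool (a \<in> S)) (\<lambda>a. of_bool (a \<in> T)) = cross S T"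
proof -
  have "(\<Sum>b\<in>X. of_bool (a \<in> S) * d a b * of_bool (b \<in> T)) = of_bool (a \<in> S) * sum (d a) T" for a
    using assms finite_points
    by (simp add: sum_distrib_left[symmetric] mult.assoc of_bool_def if_distrib[of "(*) _"]
        sum.If_cases Int_absorb1 cong: if_cong)
  then show ?thesis using assms finite_points
    by (simp add: form_def cross_def of_bool_def if_distrib[of "\<lambda>t. t * _"] sum.If_cases Int_absorb1 cong: if_cong)
qed

lemma sum_indicator: "S \<subseteq> X \<Longrightarrow> (\<Sum>a\<in>X. of_bool (a \<in> S) :: real) = card S"
  using finite_points by (simp add: of_bool_def sum.If_cases Int_absorb1)

lemma cross_commute: "S \<subseteq> X \<Longrightarrow> T \<subseteq> X \<Longrightarrow> cross S T = cross T S"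
  using form_indicator form_commute by metis

lemma cross_singleton: "cross {x} {y} = d x y"
  by (simp add: cross_def)

lemma cross_sum_left: "cross S T = (\<Sum>s\<in>S. cross {s} T)"
  by (simp add: cross_def)

lemma cross_nonneg: "S \<subseteq> X \<Longrightarrow> T \<subseteq> X \<Longrightarrow> 0 \<le> cross S T"
  unfolding cross_def by (intro sum_nonneg d_nonneg) auto

lemma dispersion_eq_cross:
  assumes "A \<subseteq> X"
  shows "dispersion d A = cross A A / 2"
proof -
  have fin: "finite A" using assms finite_points finite_subset by blast
  let ?L = "{(a, b). a \<in> A \<and> b \<in> A \<and> a < b}" and ?G = "{(a, b). a \<in> A \<and> b \<in> A \<and> b < a}"
    and ?E = "(\<lambda>a. (a, a)) ` A"
  have finLG: "finite ?L" "finite ?G"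
    by (rule finite_subset[of _ "A \<times> A"]; use fin in auto)+
  have "A \<times> A = (?L \<union> ?G) \<union> ?E" by (auto simp: image_iff)
  then have "cross A A = (\<Sum>(a, b)\<in>(?L \<union> ?G) \<union> ?E. d a b)"
    by (simp add: cross_def sum.cartesian_product)
  also have "\<dots> = (\<Sum>(a, b)\<in>?L \<union> ?G. d a b) + (\<Sum>(a, b)\<in>?E. d a b)"
    using fin finLG by (intro sum.union_disjoint) auto
  also have "(\<Sum>(a, b)\<in>?E. d a b) = 0"
    using assms d_refl by (intro sum.neutral) auto
  also have "(\<Sum>(a, b)\<in>?L \<union> ?G. d a b) = (\<Sum>(a, b)\<in>?L. d a b) + (\<Sum>(a, b)\<in>?G. d a b)"
    using finLG by (intro sum.union_disjoint) auto
  also have "(\<Sum>(a, b)\<in>?G. d a b) = (\<Sum>(a, b)\<in>?L. d a b)"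
    by (rule sum.reindex_bij_witness[of _ prod.swap prod.swap]) (use assms d_sym in auto)
  finally show ?thesis by (simp add: dispersion_def)
qed

lemma dispersion_nonneg: "A \<subseteq> X \<Longrightarrow> 0 \<le> dispersion d A"
  by (simp add: dispersion_eq_cross cross_nonneg)

lemma dispersion_mono:
  assumes "A \<subseteq> B" "B \<subseteq> X"
  shows "dispersion d A \<le> dispersion d B"
  unfolding dispersion_def
proof (rule sum_mono2)
  show "finite {(a, b). a \<in> B \<and> b \<in> B \<and> a < b}"
    by (rule finite_subset[of _ "B \<times> B"]) (use finite_subset[OF assms(2) finite_points] in auto)
qed (use assms in \<open>auto intro: d_nonneg[OF subsetD[OF assms(2)] subsetD[OF assms(2)]]\<close>)

text \<open>The form is expanded at the indicator of \<open>A\<close> minus that of \<open>U\<close>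
  plus that of \<open>V\<close>. The inequality drops the nonnegative terms for pairs inside
  \<open>U\<close> and pairs inside \<open>V\<close>.\<close>

lemma dispersion_swap:
  assumes A: "A \<subseteq> X" and U: "U \<subseteq> A" and V: "V \<subseteq> X - A"
  shows "dispersion d A - cross U A + cross V A - cross V U \<le> dispersion d (A - U \<union> V)"
proof -
  let ?i = "\<lambda>S a. of_bool (a \<in> S) :: real"
  have ind: "?i (A - U \<union> V) = (\<lambda>a. ?i A a - ?i U a + ?i V a)"
    using U V by (auto simp: fun_eq_iff)
  have sub: "U \<subseteq> X" "V \<subseteq> X" "A - U \<union> V \<subseteq> X" using assms by auto
  have "cross (A - U \<union> V) (A - U \<union> V) = cross A A - 2 * cross U A + cross U U
      + 2 * cross V A - 2 * cross V U + cross V V"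
    unfolding form_indicator[OF sub(3) sub(3), symmetric] ind form_bilinear
      form_indicator[OF A A] form_indicator[OF A sub(1)] form_indicator[OF A sub(2)]
      form_indicator[OF sub(1) A] form_indicator[OF sub(1,1)] form_indicator[OF sub(1,2)]
      form_indicator[OF sub(2) A] form_indicator[OF sub(2,1)] form_indicator[OF sub(2,2)]
    using cross_commute[OF A sub(1)] cross_commute[OF A sub(2)] cross_commute[OF sub(1,2)] by simp
  then show ?thesis
    using cross_nonneg[OF sub(1) sub(1)] cross_nonneg[OF sub(2) sub(2)] A sub
    by (simp add: dispersion_eq_cross)
qed

section \<open>Squared distances between points and centroids\<close>

text \<open>
  If \<open>d\<close> is realised as a squared Euclidean distance, this is the squared distance of \<open>u\<close> from the
  centroid of \<open>A\<close>, and \<open>gap_sq\<close> below is the squared distance of two centroids.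
\<close>

definition radius_sq :: "'a set \<Rightarrow> 'a \<Rightarrow> real" where
  "radius_sq A u = cross {u} A / card A - dispersion d A / (card A)\<^sup>2"

definition gap_sq :: "'a set \<Rightarrow> 'a set \<Rightarrow> real" where
  "gap_sq A B = cross A B / (card A * card B) - dispersion d A / (card A)\<^sup>2 - dispersion d B / (card B)\<^sup>2"

text \<open>Barycentric weights of the centroid. On weight vectors of sum 0, such as differences of
  these, the form is \<open>-2\<close> times the inner product of the realised vectors.\<close>

definition centroid :: "'a set \<Rightarrow> 'a \<Rightarrow> real" where
  "centroid A a = 1 / card A * of_bool (a \<in> A)"

lemma card_pos: "A \<subseteq> X \<Longrightarrow> A \<noteq> {} \<Longrightarrow> 0 < card A"
  using finite_points finite_subset card_gt_0_iff by metis

lemma sum_centroid: "A \<subseteq> X \<Longrightarrow> A \<noteq> {} \<Longrightarrow> sum (centroid A) X = 1"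
  using card_pos[of A] unfolding centroid_def[abs_def]
  by (simp only: sum_distrib_left[symmetric] sum_indicator) simp

lemma form_centroid:
  assumes "A \<subseteq> X" "B \<subseteq> X"
  shows "form (centroid A) (centroid B) = cross A B / (card A * card B)"
  unfolding centroid_def[abs_def] form_scale_left form_scale_right form_indicator[OF assms] by simp

lemma form_centroid_self:
  assumes "A \<subseteq> X"
  shows "form (centroid A) (centroid A) = 2 * dispersion d A / (card A)\<^sup>2"
  using assms by (simp add: form_centroid dispersion_eq_cross power2_eq_square)

lemma radius_sq_eq_form:
  assumes "A \<subseteq> X" "u \<in> X"
  shows "form (\<lambda>a. centroid {u} a - centroid A a) (\<lambda>a. centroid {u} a - centroid A a) = - 2 * radius_sq A u"
  using assms form_centroid_self[OF assms(1)]
  by (simp add: form_bilinear form_centroid cross_singleton d_refl cross_commute[of A "{u}"] radius_sq_def)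

lemma gap_sq_eq_form:
  assumes "A \<subseteq> X" "B \<subseteq> X"
  shows "form (\<lambda>a. centroid A a - centroid B a) (\<lambda>a. centroid A a - centroid B a) = - 2 * gap_sq A B"
  using assms by (simp add: form_bilinear form_centroid_self)
    (simp add: form_centroid cross_commute[of B A] gap_sq_def algebra_simps)

lemma radius_sq_nonneg:
  assumes "A \<subseteq> X" "A \<noteq> {}" "u \<in> X"
  shows "0 \<le> radius_sq A u"
  using form_nonpos[of "\<lambda>a. centroid {u} a - centroid A a"] assms radius_sq_eq_form[of A u]
  by (simp add: sum_subtractf sum_centroid)

lemma gap_sq_nonneg:
  assumes "A \<subseteq> X" "A \<noteq> {}" "B \<subseteq> X" "B \<noteq> {}"
  shows "0 \<le> gap_sq A B"
  using form_nonpos[of "\<lambda>a. centroid A a - centroid B a"] assms gap_sq_eq_form[of A B]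
  by (simp add: sum_subtractf sum_centroid)

lemma sum_radius_sq:
  assumes "A \<subseteq> X" "A \<noteq> {}"
  shows "(\<Sum>u\<in>A. radius_sq A u) = dispersion d A / card A"
proof -
  have "(\<Sum>u\<in>A. radius_sq A u) = cross A A / card A - dispersion d A / card A"
    using card_pos[OF assms] cross_sum_left[of A A]
    by (simp add: radius_sq_def sum_subtractf sum_divide_distrib[symmetric] power2_eq_square)
  then show ?thesis using assms by (simp add: dispersion_eq_cross)
qed

text \<open>On vectors of sum 0 the negated form is a squared seminorm, so this is the bound for the
  square of a sum of three vectors. The difference of the sides is the sum of the form over the
  three pairwise differences.\<close>

lemma form_three:
  assumes "sum x X = 0" "sum y X = 0" "sum z X = 0"
  shows "3 * (form x x + form y y + form z z)
    \<le> form (\<lambda>a. x a + y a + z a) (\<lambda>a. x a + y a + z a)"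
  using form_nonpos[of "\<lambda>a. x a - y a"] form_nonpos[of "\<lambda>a. y a - z a"] form_nonpos[of "\<lambda>a. x a - z a"] assms
  by (simp add: form_bilinear sum_subtractf form_commute[of y x] form_commute[of z y] form_commute[of z x])

text \<open>The vector between \<open>u\<close> and \<open>v\<close> is split into three pieces: to
  the centroid of \<open>A\<close>, to the centroid of \<open>B\<close>, and on to \<open>v\<close>.
  Then \<open>form_three\<close> applies.\<close>

lemma distance_le_centroids:
  assumes A: "A \<subseteq> X" "A \<noteq> {}" and B: "B \<subseteq> X" "B \<noteq> {}" and u: "u \<in> X" and v: "v \<in> X"
  shows "d v u \<le> 3 * (radius_sq A u + radius_sq B v + gap_sq A B)"
proof -
  let ?x = "\<lambda>a. centroid {u} a - centroid A a" and ?y = "\<lambda>a. centroid A a - centroid B a"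
    and ?z = "\<lambda>a. (-1) * (centroid {v} a - centroid B a)"
  have "(\<lambda>a. ?x a + ?y a + ?z a) = (\<lambda>a. centroid {u} a - centroid {v} a)" by (auto simp: fun_eq_iff)
  moreover have "form (\<lambda>a. centroid {u} a - centroid {v} a) (\<lambda>a. centroid {u} a - centroid {v} a) = - 2 * d v u"
    using u v by (simp add: form_bilinear form_centroid cross_singleton d_refl d_sym[of u v])
  moreover have "form ?z ?z = - 2 * radius_sq B v"
    using radius_sq_eq_form[OF B(1) v] by (simp only: form_scale_left form_scale_right)
  moreover have "sum ?x X = 0" "sum ?y X = 0" "sum ?z X = 0"
    using assms by (simp_all only: sum_subtractf sum_distrib_left[symmetric]) (simp_all add: sum_centroid)
  ultimately show ?thesis
    using form_three[of ?x ?y ?z] radius_sq_eq_form[OF A(1) u] gap_sq_eq_form[OF A(1) B(1)]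
    by simp
qed

text \<open>Replaces the second-order loss of a swap by contributions of single elements, which can
  be absorbed into linear weights.\<close>

lemma cross_le_centroids:
  assumes A: "A \<subseteq> X" "A \<noteq> {}" and B: "B \<subseteq> X" "B \<noteq> {}" and U: "U \<subseteq> X" and V: "V \<subseteq> X"
    and card: "card U \<le> q" "card V \<le> q"
  shows "cross V U \<le> 3 * q * ((\<Sum>u\<in>U. radius_sq A u) + (\<Sum>v\<in>V. radius_sq B v + gap_sq A B))"
proof -
  have rU: "0 \<le> (\<Sum>u\<in>U. radius_sq A u)"
    using radius_sq_nonneg[OF A] U by (intro sum_nonneg) auto
  have rV: "0 \<le> (\<Sum>v\<in>V. radius_sq B v + gap_sq A B)"
    using radius_sq_nonneg[OF B] gap_sq_nonneg[OF A B] V by (intro sum_nonneg add_nonneg_nonneg) auto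
  have "cross V U \<le> (\<Sum>v\<in>V. \<Sum>u\<in>U. 3 * (radius_sq A u + radius_sq B v + gap_sq A B))"
    unfolding cross_def using U V by (intro sum_mono distance_le_centroids A B) auto
  also have "\<dots> = 3 * (card V * (\<Sum>u\<in>U. radius_sq A u) + card U * (\<Sum>v\<in>V. radius_sq B v + gap_sq A B))"
    by (simp add: sum.distrib sum_distrib_left algebra_simps)
  also have "\<dots> \<le> 3 * (q * (\<Sum>u\<in>U. radius_sq A u) + q * (\<Sum>v\<in>V. radius_sq B v + gap_sq A B))"
    using card rU rV by (intro mult_left_mono add_mono mult_right_mono) auto
  finally show ?thesis by (simp add: algebra_simps)
qed

lemma dispersion_pair:
  assumes "x < y"
  shows "dispersion d {x, y} = d x y"
proof -
  have "{(a, b). a \<in> {x, y} \<and> b \<in> {x, y} \<and> a < b} = {(x, y)}" using assms by auto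
  then show ?thesis by (simp add: dispersion_def)
qed

text \<open>The farthest pair, multiplied by the number of pairs.\<close>

lemma heavy_pair:
  assumes "A \<subseteq> X" and pos: "0 < dispersion d A"
  obtains x y where "x \<in> A" "y \<in> A" "x < y" "dispersion d A \<le> (card A)\<^sup>2 * d x y"
proof -
  let ?P = "{(a, b). a \<in> A \<and> b \<in> A \<and> a < b}"
  have finA: "finite A" using assms finite_points finite_subset by blast
  have P: "?P \<subseteq> A \<times> A" by auto
  then have fin: "finite ?P" using finA finite_subset by blast
  have ne: "?P \<noteq> {}" using pos unfolding dispersion_def by (metis sum.empty less_irrefl)
  define M where "M = Max ((\<lambda>(a, b). d a b) ` ?P)"
  have "M \<in> (\<lambda>(a, b). d a b) ` ?P" unfolding M_def using fin ne by (intro Max_in) auto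
  then obtain x y where xy: "x \<in> A" "y \<in> A" "x < y" "M = d x y" by auto
  have "dispersion d A \<le> (\<Sum>_\<in>?P. M)"
    unfolding dispersion_def M_def using fin by (intro sum_mono Max_ge) auto
  also have "\<dots> = card ?P * d x y" using xy by simp
  also have "card ?P \<le> (card A)\<^sup>2"
    using card_mono[OF _ P] finA by (simp add: card_cartesian_product power2_eq_square)
  then have "real (card ?P) * d x y \<le> (card A)\<^sup>2 * d x y"
    using xy assms by (intro mult_right_mono d_nonneg) (auto simp flip: of_nat_power)
  finally show ?thesis using that xy by blast
qed

end

section \<open>Improving a feasible set by few changes\<close>

text \<open>Here \<open>a\<close> and \<open>b\<close> stand for the dispersions of \<open>A\<close>
  and \<open>B\<close>, \<open>m\<close> and \<open>k\<close> for their sizes, \<open>x\<close> for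
  their mutual distance sum, \<open>\<Gamma>\<close> for \<open>gap_sq A B\<close> and
  \<open>h\<close> for the coefficient of the second-order correction.\<close>

lemma segment_gain_arith:
  fixes a b \<delta> x \<Gamma> h m k p :: real
  assumes a: "0 \<le> a" and gap: "a \<le> (1 - \<delta>) * b" and \<delta>: "9 / p \<le> \<delta>" "\<delta> < 1"
    and p: "1 \<le> p" and m: "0 < m" and k: "0 < k" "k \<le> 2 * m" and h: "0 \<le> h" "h * p \<le> m"
    and \<Gamma>: "0 \<le> \<Gamma>" "\<Gamma> = x / (m * k) - a / m\<^sup>2 - b / k\<^sup>2"
  shows "((1 - \<delta>) * b - a) / 2 \<le> (x - h * (b / k + k * \<Gamma>)) - (1 + 1 / p) * (2 * a + h * (a / m))"
proof -
  define s r where "s = 1 / p" and "r = k / m"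
  have s: "0 < s" "s \<le> 1" "9 * s \<le> \<delta>" using p \<delta> by (auto simp: s_def)
  have r: "0 < r" "r \<le> 2" using m k by (auto simp: r_def field_simps)
  have b: "0 \<le> b" "a \<le> b"
  proof -
    have "0 \<le> (1 - \<delta>) * b" using a gap by linarith
    then show "0 \<le> b" using \<delta>(2) by (simp add: zero_le_mult_iff)
    then have "(1 - \<delta>) * b \<le> 1 * b" using s by (intro mult_right_mono) auto
    then show "a \<le> b" using gap by simp
  qed
  have hs: "h \<le> s * m" using h p by (simp add: s_def field_simps)
  \<comment> \<open>The definition of \<open>\<Gamma>\<close> solved for \<open>x\<close>. The first
    term pays for the correction \<open>h * (k * \<Gamma>)\<close>; the others bound the mutual
    distance sum from below.\<close>
  have x: "x = m * k * \<Gamma> + r * a + b / r"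
    using m k unfolding \<Gamma>(2) r_def by (simp add: field_simps power2_eq_square)
  have hb: "h * (b / k) \<le> s * (b / r)"
  proof -
    have "h * (b / k) \<le> s * m * (b / k)" using hs b k by (intro mult_right_mono) auto
    then show ?thesis using m k by (simp add: r_def mult.assoc mult.commute[of b m])
  qed
  have hk: "h * (k * \<Gamma>) \<le> m * k * \<Gamma>"
  proof -
    have "s * m \<le> 1 * m" using s m by (intro mult_right_mono) auto
    then have "h \<le> m" using hs by simp
    then have "h * (k * \<Gamma>) \<le> m * (k * \<Gamma>)" using k \<Gamma> by (intro mult_right_mono) auto
    then show ?thesis by simp
  qed
  have ha: "(1 + s) * (2 * a + h * (a / m)) \<le> (2 + 4 * s) * a"
  proof -
    have "h * (a / m) \<le> s * m * (a / m)" using hs a m by (intro mult_right_mono) auto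
    then have "2 * a + h * (a / m) \<le> (2 + s) * a" using m by (simp add: algebra_simps)
    then have "(1 + s) * (2 * a + h * (a / m)) \<le> (1 + s) * ((2 + s) * a)"
      using s by (intro mult_left_mono) auto
    also have "\<dots> = (2 + 3 * s + s * s) * a" by (simp add: algebra_simps)
    also have "\<dots> \<le> (2 + 4 * s) * a"
      using s a mult_left_mono[of s 1 s] by (intro mult_right_mono) auto
    finally show ?thesis .
  qed
  let ?T = "r * a + (1 - s) * (b / r) - (2 + 4 * s) * a"
  \<comment> \<open>The constant 9 is 1 + 8: one \<open>s\<close> is the loss on \<open>b\<close>,
    and \<open>8 * s\<close> is passed on to \<open>a\<close> by \<open>a \<le> b\<close>.\<close>
  have "(1 - \<delta>) * b - a \<le> (1 - 9 * s) * b - a" using s b by (intro diff_mono mult_right_mono) auto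
  also have "\<dots> \<le> (1 - s) * b - (1 + 8 * s) * a"
    using mult_left_mono[OF b(2), of "8 * s"] s by (simp add: algebra_simps)
  also have "\<dots> \<le> r * ?T"
  proof -
    have "r * ?T = r * r * a + (1 - s) * (r * (b / r)) - (2 * r + 4 * s * r) * a"
      by (simp only: algebra_simps)
    moreover have "r * (b / r) = b" using r by simp
    ultimately have "r * ?T = r * r * a + (1 - s) * b - (2 * r + 4 * s * r) * a" by (simp only:)
    moreover have "(2 * r + 4 * s * r - r * r) * a \<le> (1 + 8 * s) * a"
    proof (rule mult_right_mono[OF _ a])
      \<comment> \<open>So \<open>2 * r - r * r \<le> 1\<close> for every size ratio
        \<open>r\<close>. The bound \<open>r \<le> 2\<close> serves for the error term and for the
        final factor \<open>1 / 2\<close>.\<close>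
      have "0 \<le> (r - 1) * (r - 1)" by simp
      moreover have "s * r \<le> s * 2" using r s by (intro mult_left_mono) auto
      ultimately show "2 * r + 4 * s * r - r * r \<le> 1 + 8 * s" by (simp add: algebra_simps)
    qed
    ultimately show ?thesis by (simp add: algebra_simps)
  qed
  finally have rT: "(1 - \<delta>) * b - a \<le> r * ?T" .
  then have "0 \<le> r * ?T" using gap by linarith
  then have "0 \<le> ?T" using r by (simp add: zero_le_mult_iff)
  then have "r * ?T \<le> 2 * ?T" using r by (intro mult_right_mono) auto
  with rT have "(1 - \<delta>) * b - a \<le> 2 * ?T" by (rule order_trans)
  moreover have "g / 2 \<le> t" if "g \<le> 2 * t" for g t :: real using that by linarith
  ultimately have "((1 - \<delta>) * b - a) / 2 \<le> ?T" by blast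
  also have "\<dots> \<le> (x - h * (b / k + k * \<Gamma>)) - (1 + s) * (2 * a + h * (a / m))"
  proof -
    have "x1 + t1 - t2 \<le> x2 + x1 + x3 - t3 - t4"
      if "t1 = x3 - y1" "t3 = y2 + y3" "y2 \<le> y1" "y3 \<le> x2" "t4 \<le> t2"
      for x1 x2 x3 y1 y2 y3 t1 t2 t3 t4 :: real using that by linarith
    moreover have "(1 - s) * (b / r) = b / r - s * (b / r)" by (simp only: left_diff_distrib mult_1)
    moreover have "h * (b / k + k * \<Gamma>) = h * (b / k) + h * (k * \<Gamma>)" by (rule distrib_left)
    ultimately show ?thesis using hb hk ha unfolding x by blast
  qed
  finally show ?thesis by (simp add: s_def)
qed

locale dispersion_instance = negative_type_space X d + M1: matroid X I1 + M2: matroid X I2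
  for X :: "'a::linorder set" and d I1 I2
begin

abbreviation feasible :: "'a set set" where
  "feasible \<equiv> I1 \<inter> I2"

lemma feasible_subset: "A \<in> feasible \<Longrightarrow> A \<subseteq> X"
  using M1.indep_subset by auto

lemma feasible_finite: "A \<in> feasible \<Longrightarrow> finite A"
  using M1.finite_indep by auto

lemma feasible_hereditary: "A \<in> feasible \<Longrightarrow> B \<subseteq> A \<Longrightarrow> B \<in> feasible"
  using M1.hereditary[of A B] M2.hereditary[of A B] by simp

lemma feasible_card: "A \<in> feasible \<Longrightarrow> card A \<le> card X"
  using feasible_subset finite_points by (simp add: card_mono)

lemma segment_improvement:
  fixes p :: nat
  assumes A: "A \<in> feasible" and B: "B \<in> feasible"
    and gap: "dispersion d A \<le> (1 - \<delta>) * dispersion d B" and \<delta>: "9 / p \<le> \<delta>" "\<delta> < 1" and p: "0 < p"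
    and large: "3 * p * (p + 1) \<le> card A" and B0: "B \<noteq> {}" and ratio: "card B \<le> 2 * card A"
  shows "\<exists>C\<in>feasible. card (sym_diff A C) \<le> 2 * p + 1 \<and>
    (1 - \<delta>) * dispersion d B - dispersion d A \<le> 2 * card X * (dispersion d C - dispersion d A)"
proof -
  \<comment> \<open>The factor from \<open>cross_le_centroids\<close> for exchanges of at most
    \<open>p + 1\<close> elements on either side. The corrections in \<open>w\<close> and
    \<open>c\<close> then cover \<open>cross V U\<close>, and \<open>large\<close> says that
    \<open>h * p \<le> card A\<close>.\<close>
  define h where "h = 3 * real (p + 1)"
  define w where "w v = cross {v} A - h * (radius_sq B v + gap_sq A B)" for v
  define c where "c u = cross {u} A + h * radius_sq A u" for u
  have sub: "A \<subseteq> X" "B \<subseteq> X" using A B feasible_subset by auto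
  have fin: "finite A" "finite B" using A B feasible_finite by auto
  have "0 < 3 * p * (p + 1)" using p by simp
  then have "0 < card A" using large by linarith
  then have A0: "A \<noteq> {}" by auto
  have cardB: "0 < card B" using card_pos sub B0 by blast
  have h0: "0 \<le> h" by (simp add: h_def)
  have rA: "0 \<le> radius_sq A u" if "u \<in> X" for u using radius_sq_nonneg[OF sub(1) A0 that] .
  have rB: "0 \<le> radius_sq B v" if "v \<in> X" for v using radius_sq_nonneg[OF sub(2) B0 that] .
  have g: "0 \<le> gap_sq A B" using gap_sq_nonneg[OF sub(1) A0 sub(2) B0] .
  have crossA: "0 \<le> cross {u} A" if "u \<in> X" for u using cross_nonneg that sub by simp
  have c0: "\<forall>u\<in>A. 0 \<le> c u"
    using sub rA crossA h0 by (auto simp: c_def)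
  have wc: "w x \<le> c x" if "x \<in> A \<inter> B" for x
  proof -
    have x: "x \<in> X" using that sub by auto
    have "0 \<le> h * (radius_sq B x + gap_sq A B)" "0 \<le> h * radius_sq A x"
      using h0 rB[OF x] rA[OF x] g by auto
    then show ?thesis by (simp add: w_def c_def)
  qed
  have wB: "sum w B = cross A B - h * (dispersion d B / card B + card B * gap_sq A B)"
    using cross_sum_left[of B A] cross_commute[OF sub] sum_radius_sq[OF sub(2) B0]
    by (simp add: w_def sum_subtractf sum_distrib_left[symmetric] sum.distrib)
  have cA: "sum c A = 2 * dispersion d A + h * (dispersion d A / card A)"
    using cross_sum_left[of A A] dispersion_eq_cross[OF sub(1)] sum_radius_sq[OF sub(1) A0]
    by (simp add: c_def sum_distrib_left[symmetric] sum.distrib)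
  have "((1 - \<delta>) * dispersion d B - dispersion d A) / 2 \<le> sum w B - (1 + 1 / p) * sum c A"
    unfolding wB cA
  proof (rule segment_gain_arith)
    show "h * real p \<le> real (card A)"
    proof -
      have "h * real p = real (3 * p * (p + 1))" by (simp add: h_def algebra_simps)
      then show ?thesis using large by (simp only: of_nat_le_iff)
    qed
    show "real (card B) \<le> 2 * real (card A)" using ratio by linarith
    show "gap_sq A B = cross A B / (real (card A) * real (card B)) - dispersion d A / (real (card A))\<^sup>2
        - dispersion d B / (real (card B))\<^sup>2" by (simp add: gap_sq_def)
  qed (use gap \<delta> p h0 g cardB \<open>0 < card A\<close> dispersion_nonneg[OF sub(1)] in auto)
  \<comment> \<open>Common elements are not exchanged; as \<open>w \<le> c\<close> on them, omitting
    them does not lower the bound.\<close>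
  also have "\<dots> \<le> sum w (B - A) - (1 + 1 / p) * sum c (A - B)"
  proof -
    have "sum w B = sum w (B - A) + sum w (A \<inter> B)" "sum c A = sum c (A - B) + sum c (A \<inter> B)"
      using fin by (auto simp: Int_commute sum.Int_Diff[of B w A] sum.Int_Diff[of A c B])
    moreover have "sum w (A \<inter> B) \<le> sum c (A \<inter> B)" using wc by (intro sum_mono) auto
    moreover have "0 \<le> sum c (A \<inter> B)" using c0 by (intro sum_nonneg) auto
    then have "sum c (A \<inter> B) \<le> (1 + 1 / p) * sum c (A \<inter> B)" by (simp add: algebra_simps)
    ultimately show ?thesis by (simp add: distrib_left)
  qed
  finally have lower: "((1 - \<delta>) * dispersion d B - dispersion d A) / 2
    \<le> sum w (B - A) - (1 + 1 / p) * sum c (A - B)" .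
  moreover have "0 \<le> ((1 - \<delta>) * dispersion d B - dispersion d A) / 2" using gap by simp
  ultimately have "0 \<le> sum w (B - A) - (1 + 1 / p) * sum c (A - B)" by (rule order_trans[rotated])
  from common_exchange[OF M1.matroid_axioms M2.matroid_axioms A B c0 p this]
  obtain U V where UV: "U \<subseteq> A" "V \<subseteq> B - A" "card V \<le> p" "card U \<le> p + 1" "A - U \<union> V \<in> feasible"
    "sum w (B - A) - (1 + 1 / p) * sum c (A - B) \<le> card X * (sum w V - sum c U)"
    by (elim exE conjE) (rule that; assumption)
  have subUV: "U \<subseteq> X" "V \<subseteq> X" "V \<subseteq> X - A" using UV sub by auto
  have "sum w V - sum c U \<le> cross V A - cross U A - cross V U"
  proof -
    have "cross V U \<le> 3 * real (p + 1) * ((\<Sum>u\<in>U. radius_sq A u) + (\<Sum>v\<in>V. radius_sq B v + gap_sq A B))"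
      using cross_le_centroids[OF sub(1) A0 sub(2) B0 subUV(1,2), of "p + 1"] UV(3,4) by simp
    moreover have "sum w V = cross V A - h * (\<Sum>v\<in>V. radius_sq B v + gap_sq A B)"
      using cross_sum_left[of V A] by (simp add: w_def sum_subtractf sum_distrib_left[symmetric])
    moreover have "sum c U = cross U A + h * (\<Sum>u\<in>U. radius_sq A u)"
      using cross_sum_left[of U A] by (simp add: c_def sum_distrib_left[symmetric] sum.distrib)
    ultimately show ?thesis by (simp add: h_def distrib_left)
  qed
  also have "\<dots> \<le> dispersion d (A - U \<union> V) - dispersion d A"
    using dispersion_swap[OF sub(1) UV(1) subUV(3)] by linarith
  finally have "card X * (sum w V - sum c U) \<le> card X * (dispersion d (A - U \<union> V) - dispersion d A)"
    by (intro mult_left_mono) auto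
  from order_trans[OF order_trans[OF lower UV(6)] this]
  have "(1 - \<delta>) * dispersion d B - dispersion d A
      \<le> 2 * card X * (dispersion d (A - U \<union> V) - dispersion d A)" by simp
  moreover have "card (sym_diff A (A - U \<union> V)) \<le> 2 * p + 1"
  proof -
    have finUV: "finite U" "finite V" using UV fin finite_subset by (blast, blast)
    have "card (sym_diff A (A - U \<union> V)) \<le> card (U \<union> V)"
      using finUV by (intro card_mono) auto
    then show ?thesis using card_Un_le[of U V] UV(3,4) by linarith
  qed
  ultimately show ?thesis using UV(5) by blast
qed

text \<open>Negative type forces every point \<open>x\<close> to have distance sum at least \<open>d(A) / card A\<close> to \<open>A\<close>.\<close>

lemma augmentation_improvement:
  assumes A: "A \<in> feasible" and B: "B \<in> feasible" and ratio: "2 * card A < card B" and A0: "A \<noteq> {}"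
  shows "\<exists>C\<in>feasible. card (sym_diff A C) \<le> 1 \<and>
    dispersion d A \<le> card A * (dispersion d C - dispersion d A)"
proof -
  have sub: "A \<subseteq> X" "B \<subseteq> X" using A B feasible_subset by auto
  have fin: "finite A" "finite B" using A B feasible_finite by auto
  obtain W1 where W1: "W1 \<in> I1" "A \<subseteq> W1" "W1 \<subseteq> A \<union> B" "card W1 = card B"
    using M1.extend_indep[of A B] A B ratio by auto
  obtain W2 where W2: "W2 \<in> I2" "A \<subseteq> W2" "W2 \<subseteq> A \<union> B" "card W2 = card B"
    using M2.extend_indep[of A B] A B ratio by auto
  have cards: "card (W1 - A) = card B - card A" "card (W2 - A) = card B - card A"
    using W1 W2 fin by (auto simp: card_Diff_subset)
  \<comment> \<open>Both sets contain more than half of the elements of \<open>B\<close>.\<close>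
  have "(W1 - A) \<inter> (W2 - A) \<noteq> {}"
  proof
    assume disj: "(W1 - A) \<inter> (W2 - A) = {}"
    have sb: "(W1 - A) \<union> (W2 - A) \<subseteq> B" using W1 W2 by blast
    have "finite (W1 - A)" "finite (W2 - A)"
      using sb fin(2) finite_subset[of "W1 - A" B] finite_subset[of "W2 - A" B] by auto
    then have "card (W1 - A) + card (W2 - A) = card ((W1 - A) \<union> (W2 - A))"
      using disj by (simp add: card_Un_disjoint)
    also have "\<dots> \<le> card B" using sb fin by (intro card_mono) auto
    finally show False using cards ratio by linarith
  qed
  then obtain x where x: "x \<in> W1" "x \<in> W2" "x \<notin> A" by blast
  have "insert x A \<in> feasible"
    using M1.hereditary[OF W1(1), of "insert x A"] M2.hereditary[OF W2(1), of "insert x A"] x W1 W2 by auto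
  moreover have xX: "x \<in> X" using x W1 sub by auto
  moreover have "dispersion d A \<le> card A * (dispersion d (insert x A) - dispersion d A)"
  proof -
    have "dispersion d A + cross {x} A \<le> dispersion d (insert x A)"
      using dispersion_swap[OF sub(1), of "{}" "{x}"] x xX by (simp add: cross_def)
    moreover have "dispersion d A / card A \<le> cross {x} A"
      using radius_sq_nonneg[OF sub(1) A0 xX] card_pos[OF sub(1) A0]
      by (simp add: radius_sq_def field_simps power2_eq_square)
    ultimately have "dispersion d A / card A \<le> dispersion d (insert x A) - dispersion d A" by linarith
    then show ?thesis using card_pos[OF sub(1) A0] by (simp add: field_simps)
  qed
  moreover have "sym_diff A (insert x A) = {x}" using x by auto
  ultimately show ?thesis by (metis card_1_singleton_iff order_refl One_nat_def)
qed

text \<open>Extending \<open>{x, y}\<close> inside \<open>A\<close> to the size of \<open>A\<close>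
  loses at most two elements of \<open>A\<close> in each matroid. The intersection of the two
  extensions loses at most four and gains at most two.\<close>

lemma pair_exchange:
  assumes A: "A \<in> feasible" and xy: "{x, y} \<in> feasible"
  shows "\<exists>C\<in>feasible. {x, y} \<subseteq> C \<and> card (sym_diff A C) \<le> 6"
proof (cases "2 \<le> card A")
  case True
  have fin: "finite A" using A feasible_finite by auto
  have two: "card {x, y} \<le> 2" by (simp add: card_insert_if)
  obtain W1 where W1: "W1 \<in> I1" "{x, y} \<subseteq> W1" "W1 \<subseteq> {x, y} \<union> A" "card W1 = card A"
    using M1.extend_indep[of "{x, y}" A] A xy two True by auto
  obtain W2 where W2: "W2 \<in> I2" "{x, y} \<subseteq> W2" "W2 \<subseteq> {x, y} \<union> A" "card W2 = card A"
    using M2.extend_indep[of "{x, y}" A] A xy two True by auto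
  have miss: "card (A - W) \<le> 2" if "W \<subseteq> {x, y} \<union> A" "card W = card A" for W
  proof -
    have "finite W" using that(1) fin finite_subset by auto
    have "card (A - W) = card (A \<union> W) - card W"
      using card_Diff_subset[OF \<open>finite W\<close>, of "A \<union> W"] by (simp add: Un_Diff)
    also have "card (A \<union> W) \<le> card ({x, y} \<union> A)" using that fin by (intro card_mono) auto
    then have "card (A \<union> W) \<le> 2 + card A" using card_Un_le[of "{x, y}" A] two by linarith
    then have "card (A \<union> W) - card W \<le> 2" using that(2) by linarith
    finally show ?thesis .
  qed
  have "card (sym_diff A (W1 \<inter> W2)) \<le> card ((A - W1) \<union> (A - W2) \<union> {x, y})"
    using fin W1(3) by (intro card_mono) auto
  also have "\<dots> \<le> card (A - W1) + card (A - W2) + card {x, y}"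
    using card_Un_le[of "(A - W1) \<union> (A - W2)" "{x, y}"] card_Un_le[of "A - W1" "A - W2"] by linarith
  also have "\<dots> \<le> 6" using miss[OF W1(3,4)] miss[OF W2(3,4)] two by linarith
  finally have "card (sym_diff A (W1 \<inter> W2)) \<le> 6" .
  moreover have "W1 \<inter> W2 \<in> feasible"
    using M1.hereditary[OF W1(1), of "W1 \<inter> W2"] M2.hereditary[OF W2(1), of "W1 \<inter> W2"] by auto
  ultimately show ?thesis using W1(2) W2(2) by (intro bexI[of _ "W1 \<inter> W2"]) auto
next
  case False
  have "card (sym_diff A {x, y}) \<le> card (A \<union> {x, y})"
    using A feasible_finite by (intro card_mono) auto
  also have "\<dots> \<le> 6" using card_Un_le[of A "{x, y}"] False card_insert_le_m1[of 2 "{y}" x] by auto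
  finally show ?thesis using xy by blast
qed

text \<open>If \<open>A\<close> already has a share of about \<open>1 / (card B)^2\<close> of the
  dispersion of \<open>B\<close>, adding one element suffices. Otherwise a set containing the
  farthest pair of \<open>B\<close> has more than twice the dispersion of \<open>A\<close>.\<close>

lemma unbalanced_improvement:
  assumes A: "A \<in> feasible" and B: "B \<in> feasible" and ratio: "2 * card A < card B"
    and pos: "0 < dispersion d B"
  shows "\<exists>C\<in>feasible. card (sym_diff A C) \<le> 6 \<and> dispersion d A \<le> dispersion d C \<and>
    dispersion d B \<le> 2 * real (card X) ^ 3 * (dispersion d C - dispersion d A)"
proof -
  let ?n = "real (card X)" and ?k = "real (card B)"
  have sub: "A \<subseteq> X" "B \<subseteq> X" using A B feasible_subset by auto
  have kn: "?k \<le> ?n" "real (card A) \<le> ?n" using feasible_card A B by auto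
  have n1: "1 \<le> ?n" using kn ratio by linarith
  have k2: "?k\<^sup>2 \<le> ?n\<^sup>2" using kn by (intro power_mono) auto
  have "?n\<^sup>2 \<le> ?n ^ 3" using n1 by (intro power_increasing) auto
  then have k3: "2 * ?k\<^sup>2 \<le> 2 * ?n ^ 3" using k2 by linarith
  show ?thesis
  proof (cases "dispersion d B \<le> 2 * ?k\<^sup>2 * dispersion d A")
    case True
    then have "dispersion d A \<noteq> 0" using pos by auto
    then have A0: "A \<noteq> {}" by (auto simp: dispersion_def)
    obtain C where C: "C \<in> feasible" "card (sym_diff A C) \<le> 1"
      "dispersion d A \<le> card A * (dispersion d C - dispersion d A)"
      using augmentation_improvement[OF A B ratio A0] by blast
    have "0 < real (card A)" using card_pos[OF sub(1) A0] by simp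
    moreover have "0 \<le> dispersion d A" using dispersion_nonneg sub by simp
    ultimately have gain: "0 \<le> dispersion d C - dispersion d A"
      using C(3) by (smt (verit) mult_pos_neg)
    have "dispersion d B \<le> 2 * ?n\<^sup>2 * (?n * (dispersion d C - dispersion d A))"
    proof -
      have "2 * ?k\<^sup>2 * dispersion d A \<le> 2 * ?n\<^sup>2 * (card A * (dispersion d C - dispersion d A))"
        using k2 C(3) dispersion_nonneg sub by (intro mult_mono) auto
      also have "\<dots> \<le> 2 * ?n\<^sup>2 * (?n * (dispersion d C - dispersion d A))"
        using kn gain by (intro mult_left_mono mult_right_mono) auto
      finally show ?thesis using True by linarith
    qed
    also have "\<dots> = 2 * ?n ^ 3 * (dispersion d C - dispersion d A)"
      by (simp add: power2_eq_square power3_eq_cube)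
    finally show ?thesis using C gain by (intro bexI[of _ C]) auto
  next
    case False
    obtain x y where xy: "x \<in> B" "y \<in> B" "x < y" "dispersion d B \<le> ?k\<^sup>2 * d x y"
      using heavy_pair[OF sub(2) pos] by auto
    then have "{x, y} \<in> feasible" using feasible_hereditary[OF B] by simp
    then obtain C where C: "C \<in> feasible" "{x, y} \<subseteq> C" "card (sym_diff A C) \<le> 6"
      using pair_exchange[OF A] by blast
    have k0: "0 < ?k\<^sup>2" using ratio by simp
    have "d x y \<le> dispersion d C"
      using dispersion_mono[OF C(2)] feasible_subset[OF C(1)] dispersion_pair[OF xy(3)] by simp
    then have "?k\<^sup>2 * d x y \<le> ?k\<^sup>2 * dispersion d C" by (intro mult_left_mono) auto
    then have kC: "dispersion d B \<le> ?k\<^sup>2 * dispersion d C" using xy(4) by linarith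
    then have gap: "dispersion d B \<le> 2 * ?k\<^sup>2 * (dispersion d C - dispersion d A)"
      using False by (simp add: algebra_simps)
    then have "0 < ?k\<^sup>2 * (dispersion d C - dispersion d A)" using pos by linarith
    then have gain: "0 \<le> dispersion d C - dispersion d A" using k0 by (simp add: zero_less_mult_iff)
    note gap
    also have "2 * ?k\<^sup>2 * (dispersion d C - dispersion d A) \<le> 2 * ?n ^ 3 * (dispersion d C - dispersion d A)"
      using gain by (intro mult_right_mono k3)
    finally show ?thesis using C gain by (intro bexI[of _ C]) auto
  qed
qed

text \<open>The largest exchange occurs when \<open>card A < 3 * p * (p + 1)\<close> and
  \<open>card B \<le> 2 * card A\<close>. Then \<open>C = B\<close> is within reach, since the union
  has at most \<open>3 * card A\<close> elements. The other cases change at most 6 or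
  \<open>2 * p + 1\<close> elements.\<close>

lemma local_improvement:
  fixes p :: nat
  assumes A: "A \<in> feasible" and B: "B \<in> feasible"
    and \<delta>: "9 / p \<le> \<delta>" "\<delta> < 1" and p: "0 < p"
  shows "\<exists>C\<in>feasible. card (sym_diff A C) \<le> 9 * p * (p + 1) \<and> dispersion d A \<le> dispersion d C \<and>
    (1 - \<delta>) * dispersion d B - dispersion d A \<le> 2 * real (card X) ^ 3 * (dispersion d C - dispersion d A)"
proof (cases "(1 - \<delta>) * dispersion d B \<le> dispersion d A")
  case True
  then show ?thesis using A by (intro bexI[of _ A]) auto
next
  case False
  let ?gap = "(1 - \<delta>) * dispersion d B - dispersion d A"
  have sub: "A \<subseteq> X" "B \<subseteq> X" using A B feasible_subset by auto
  have nonneg: "0 \<le> dispersion d A" "0 \<le> dispersion d B" using sub dispersion_nonneg by auto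
  have "0 < (1 - \<delta>) * dispersion d B" using False nonneg by linarith
  then have pos: "0 < dispersion d B" using \<delta> by (simp add: zero_less_mult_iff)
  have \<delta>0: "0 \<le> \<delta>" using \<delta>(1) by (smt (verit) divide_nonneg_nonneg of_nat_0_le_iff)
  have gapB: "?gap \<le> dispersion d B - dispersion d A"
    using mult_right_mono[of "1 - \<delta>" 1 "dispersion d B"] \<delta>0 nonneg by simp
  have p2: "18 \<le> 9 * p * (p + 1)" "2 * p + 1 \<le> 9 * p * (p + 1)"
    using p by (cases p; simp)+
  have B0: "B \<noteq> {}" using pos by (auto simp: dispersion_def)
  have "1 \<le> card X" using card_pos[OF sub(2) B0] feasible_card[OF B] by linarith
  then have n1: "1 \<le> real (card X)" by simp
  consider "2 * card A < card B" | "card B \<le> 2 * card A" "card A < 3 * p * (p + 1)"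
    | "card B \<le> 2 * card A" "3 * p * (p + 1) \<le> card A" by linarith
  then show ?thesis
  proof cases
    case 1
    then obtain C where C: "C \<in> feasible" "card (sym_diff A C) \<le> 6" "dispersion d A \<le> dispersion d C"
      "dispersion d B \<le> 2 * real (card X) ^ 3 * (dispersion d C - dispersion d A)"
      using unbalanced_improvement[OF A B _ pos] by blast
    then show ?thesis using gapB nonneg p2 by (intro bexI[of _ C]) auto
  next
    case 2
    have "card (sym_diff A B) \<le> card (A \<union> B)"
      using A B feasible_finite by (intro card_mono) auto
    also have "\<dots> \<le> 3 * card A" using card_Un_le[of A B] 2 by linarith
    also have "\<dots> \<le> 9 * p * (p + 1)" using 2 by simp
    finally have "card (sym_diff A B) \<le> 9 * p * (p + 1)" .
    moreover have gain: "0 \<le> dispersion d B - dispersion d A" using gapB False by linarith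
    moreover have "1 \<le> 2 * real (card X) ^ 3" using one_le_power[OF n1, of 3] by linarith
    then have "1 * (dispersion d B - dispersion d A) \<le> 2 * real (card X) ^ 3 * (dispersion d B - dispersion d A)"
      using gain by (intro mult_right_mono)
    ultimately show ?thesis using B gapB by (intro bexI[of _ B]) auto
  next
    case 3
    then obtain C where C: "C \<in> feasible" "card (sym_diff A C) \<le> 2 * p + 1"
      "?gap \<le> 2 * card X * (dispersion d C - dispersion d A)"
      using segment_improvement[OF A B _ \<delta> p _ B0] False by auto
    have "0 < real (card X) * (dispersion d C - dispersion d A)" using C(3) False by linarith
    then have gain: "0 \<le> dispersion d C - dispersion d A" by (simp add: zero_less_mult_iff)
    have "real (card X) \<le> real (card X) ^ 3" using power_increasing[OF _ n1, of 1 3] by simp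
    then have "2 * card X * (dispersion d C - dispersion d A)
        \<le> 2 * real (card X) ^ 3 * (dispersion d C - dispersion d A)"
      using gain by (intro mult_right_mono) auto
    then show ?thesis using C gain p2 by (intro bexI[of _ C]) auto
  qed
qed

end

section \<open>The local search program\<close>

definition runs :: "input \<Rightarrow> com \<Rightarrow> state \<Rightarrow> nat \<Rightarrow> (state \<Rightarrow> bool) \<Rightarrow> bool" where
  "runs P c s t Q \<longleftrightarrow> (\<exists>u s'. exec P c s u s' \<and> u \<le> t \<and> Q s')"

lemma runs_mono:
  assumes "runs P c s t Q" "t \<le> t'" "\<And>s'. Q s' \<Longrightarrow> Q' s'"
  shows "runs P c s t' Q'"
  using assms unfolding runs_def by (meson order_trans)

lemma runs_Skip: "Q s \<Longrightarrow> runs P Skip s 1 Q"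
  unfolding runs_def by (intro exI conjI, rule exec.Skip) auto

lemma runs_NAssign: "Q (nupdate a (nval P e s) (nval P f s) s) \<Longrightarrow> runs P (NAssign a e f) s 1 Q"
  unfolding runs_def by (intro exI conjI, rule exec.NAssign) auto

lemma runs_RAssign: "Q (rupdate a (nval P e s) (rval P f s) s) \<Longrightarrow> runs P (RAssign a e f) s 1 Q"
  unfolding runs_def by (intro exI conjI, rule exec.RAssign) auto

lemma runs_Seq:
  assumes "runs P c s t R" "\<And>s'. R s' \<Longrightarrow> runs P c' s' t' Q"
  shows "runs P (Seq c c') s (t + t') Q"
proof -
  obtain u s' where s': "exec P c s u s'" "u \<le> t" "R s'" using assms(1) by (auto simp: runs_def)
  obtain u' s'' where s'': "exec P c' s' u' s''" "u' \<le> t'" "Q s''"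
    using assms(2)[OF s'(3)] by (auto simp: runs_def)
  show ?thesis
    unfolding runs_def using exec.Seq[OF s'(1) s''(1)] s' s'' add_mono by blast
qed

lemma runs_Cond:
  assumes "bval P b s \<Longrightarrow> runs P c s t Q" "\<not> bval P b s \<Longrightarrow> runs P c' s t Q"
  shows "runs P (Cond b c c') s (t + 1) Q"
proof (cases "bval P b s")
  case True
  then obtain u s' where "exec P c s u s'" "u \<le> t" "Q s'" using assms(1) by (auto simp: runs_def)
  then show ?thesis
    using exec.CondTrue[OF True] unfolding runs_def by (intro exI[of _ "Suc u"] exI[of _ s']) auto
next
  case False
  then obtain u s' where "exec P c' s u s'" "u \<le> t" "Q s'" using assms(2) by (auto simp: runs_def)
  then show ?thesis
    using exec.CondFalse[OF False] unfolding runs_def by (intro exI[of _ "Suc u"] exI[of _ s']) auto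
qed

text \<open>Array 3 holds the loop counters, each at a fixed address.\<close>

abbreviation counter :: "nat \<Rightarrow> nexp" where
  "counter k \<equiv> NArr 3 (NConst k)"

definition for_loop :: "nat \<Rightarrow> nexp \<Rightarrow> com \<Rightarrow> com" where
  "for_loop k e c = Seq (NAssign 3 (NConst k) (NConst 0))
     (While (NLess (counter k) e) (Seq c (NAssign 3 (NConst k) (NAdd (counter k) (NConst 1)))))"

text \<open>Each round costs the body, one test and one increment; the initial assignment and the
  failing test add 2.\<close>

definition for_time :: "nat \<Rightarrow> nat \<Rightarrow> nat" where
  "for_time N t = N * (t + 2) + 2"

lemma for_time_mono: "M \<le> N \<Longrightarrow> t \<le> u \<Longrightarrow> for_time M t \<le> for_time N u"
  unfolding for_time_def by (intro add_mono mult_mono) auto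

text \<open>The loop bound is evaluated anew in every test, so the invariant has to fix its value.
  The invariant is required after the counter update because it may itself speak about array
  3.\<close>

lemma runs_for:
  assumes init: "I 0 (nupdate 3 k 0 s)"
    and step: "\<And>i s. i < N \<Longrightarrow> I i s \<Longrightarrow> fst s 3 k = i \<Longrightarrow>
      runs P c s t (\<lambda>s'. fst s' 3 k = i \<and> I (Suc i) (nupdate 3 k (Suc i) s'))"
    and bound: "\<And>i s. I i s \<Longrightarrow> nval P e s = N"
    and final: "\<And>s. I N s \<Longrightarrow> Q s"
  shows "runs P (for_loop k e c) s (for_time N t) Q"
proof -
  let ?body = "Seq c (NAssign 3 (NConst k) (NAdd (counter k) (NConst 1)))"
  let ?while = "While (NLess (counter k) e) ?body"
  have loop: "runs P ?while s ((N - i) * (t + 2) + 1) Q" if "I i s" "fst s 3 k = i" "i \<le> N" for i s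
    using that
  proof (induction "N - i" arbitrary: i s)
    case 0
    then have "\<not> bval P (NLess (counter k) e) s" using bound by auto
    moreover have "Q s" using 0 final by simp
    ultimately show ?case
      unfolding runs_def
      using exec.WhileFalse[of P "NLess (counter k) e" s ?body] by (intro exI[of _ 1] exI[of _ s]) simp
  next
    case (Suc m)
    then have i: "i < N" by simp
    have "runs P ?body s (t + 1) (\<lambda>s'. I (Suc i) s' \<and> fst s' 3 k = Suc i)"
      by (rule runs_Seq[OF step[OF i Suc.prems(1,2)]], rule runs_NAssign) (auto simp: nupdate_def)
    then obtain u s' where s': "exec P ?body s u s'" "u \<le> t + 1" "I (Suc i) s'" "fst s' 3 k = Suc i"
      by (auto simp: runs_def)
    have "runs P ?while s' ((N - Suc i) * (t + 2) + 1) Q"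
      using Suc.hyps(2) s' i by (intro Suc.hyps(1)) auto
    then obtain u' s'' where s'': "exec P ?while s' u' s''" "u' \<le> (N - Suc i) * (t + 2) + 1" "Q s''"
      by (auto simp: runs_def)
    have "bval P (NLess (counter k) e) s" using i Suc.prems bound by simp
    then have "exec P ?while s (Suc (u + u')) s''" using s' s'' by (intro exec.WhileTrue)
    moreover have "N - i = Suc (N - Suc i)" using i by simp
    then have "Suc (u + u') \<le> (N - i) * (t + 2) + 1" using s'(2) s''(2) by simp
    ultimately show ?case using s''(3) unfolding runs_def by blast
  qed
  have "runs P (for_loop k e c) s (1 + ((N - 0) * (t + 2) + 1)) Q"
    unfolding for_loop_def
  proof (rule runs_Seq)
    show "runs P (NAssign 3 (NConst k) (NConst 0)) s 1 (\<lambda>s'. I 0 s' \<and> fst s' 3 k = 0)"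
      by (rule runs_NAssign) (use init in \<open>simp add: nupdate_def\<close>)
    show "runs P ?while s' ((N - 0) * (t + 2) + 1) Q" if "I 0 s' \<and> fst s' 3 k = 0" for s'
      using loop[of 0 s'] that by simp
  qed
  then show ?thesis by (simp add: for_time_def)
qed

text \<open>Nested loops use increasing cells of array 3, and inner programs may overwrite only the
  counters below their level \<open>j\<close>.\<close>

definition keeps :: "nat \<Rightarrow> state \<Rightarrow> state \<Rightarrow> bool" where
  "keeps j s s' \<longleftrightarrow> (\<forall>a. a \<noteq> 3 \<longrightarrow> fst s' a = fst s a) \<and> (\<forall>k\<ge>j. fst s' 3 k = fst s 3 k)"

text \<open>
  Natural array 0 holds the best set found so far and array 1 the current candidate; cells 0 and 1
  of real array 0 hold their dispersions.
\<close>

definition evaluate :: com where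
  "evaluate = Seq (RAssign 0 (NConst 1) (RConst 0))
     (for_loop 0 NSize (for_loop 1 (counter 0)
       (Cond (BAnd (NLess (NConst 0) (NArr 1 (counter 0))) (NLess (NConst 0) (NArr 1 (counter 1))))
         (RAssign 0 (NConst 1) (RAdd (RArr 0 (NConst 1)) (RDist (counter 1) (counter 0))))
         Skip)))"

definition copy :: "nat \<Rightarrow> nat \<Rightarrow> com" where
  "copy a b = for_loop 0 NSize (NAssign b (counter 0) (NArr a (counter 0)))"

definition test :: com where
  "test = Cond (BAnd (Indep1 1) (Indep2 1))
     (Seq evaluate
       (Cond (RLess (RArr 0 (NConst 0)) (RArr 0 (NConst 1)))
         (Seq (RAssign 0 (NConst 0) (RArr 0 (NConst 1))) (copy 1 0))
         Skip))
     Skip"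

text \<open>Truncated subtraction sends 0 to 1 and every nonzero value to 0, so membership flips
  whichever nonzero value encodes it.\<close>

definition toggle :: "nat \<Rightarrow> com" where
  "toggle k = NAssign 1 (counter k) (NSub (NConst 1) (NArr 1 (counter k)))"

text \<open>
  The last index of each loop toggles a cell outside the ground set, so that changes of fewer than
  \<open>j\<close> elements are covered as well.
\<close>

fun search :: "nat \<Rightarrow> com" where
  "search 0 = test"
| "search (Suc j) = for_loop (j + 2) (NAdd NSize (NConst 1)) (Seq (toggle (j + 2)) (Seq (search j) (toggle (j + 2))))"

text \<open>Nesting \<open>m\<close> loops yields \<open>(n + K) ^ m\<close> rounds in a language
  without multiplication. The counters from \<open>q + 2\<close> on lie above those of
  \<open>search q\<close>.\<close>

fun iterate :: "nat \<Rightarrow> nat \<Rightarrow> nat \<Rightarrow> com" where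
  "iterate q K 0 = Seq (copy 0 1) (search q)"
| "iterate q K (Suc m) = for_loop (q + 2 + m) (NAdd NSize (NConst K)) (iterate q K m)"

section \<open>Polynomial step bounds\<close>

definition evaluate_time :: "nat \<Rightarrow> nat" where
  "evaluate_time n = 1 + for_time n (for_time n 2)"

definition test_time :: "nat \<Rightarrow> nat" where
  "test_time n = (evaluate_time n + ((1 + for_time n 1) + 1)) + 1"

fun search_time :: "nat \<Rightarrow> nat \<Rightarrow> nat" where
  "search_time 0 n = test_time n"
| "search_time (Suc j) n = for_time (n + 1) (1 + (search_time j n + 1))"

fun iterate_time :: "nat \<Rightarrow> nat \<Rightarrow> nat \<Rightarrow> nat \<Rightarrow> nat" where
  "iterate_time q K 0 n = for_time n 1 + search_time q n"
| "iterate_time q K (Suc m) n = for_time (n + K) (iterate_time q K m n)"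

definition polynomial_nat :: "(nat \<Rightarrow> nat) \<Rightarrow> bool" where
  "polynomial_nat f \<longleftrightarrow> (\<exists>p. \<forall>n. f n = poly p n)"

lemma polynomial_nat_const: "polynomial_nat (\<lambda>n. c)"
  unfolding polynomial_nat_def by (intro exI[of _ "[:c:]"]) simp

lemma polynomial_nat_ident: "polynomial_nat (\<lambda>n. n)"
  unfolding polynomial_nat_def by (intro exI[of _ "[:0, 1:]"]) simp

lemma polynomial_nat_add: "polynomial_nat f \<Longrightarrow> polynomial_nat g \<Longrightarrow> polynomial_nat (\<lambda>n. f n + g n)"
  unfolding polynomial_nat_def by (metis poly_add)

lemma polynomial_nat_mult: "polynomial_nat f \<Longrightarrow> polynomial_nat g \<Longrightarrow> polynomial_nat (\<lambda>n. f n * g n)"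
  unfolding polynomial_nat_def by (metis poly_mult)

lemmas polynomial_nat_intros = polynomial_nat_add polynomial_nat_mult polynomial_nat_const polynomial_nat_ident

lemma polynomial_nat_for: "polynomial_nat f \<Longrightarrow> polynomial_nat g \<Longrightarrow> polynomial_nat (\<lambda>n. for_time (f n) (g n))"
  unfolding for_time_def by (intro polynomial_nat_intros)

lemma polynomial_nat_search_time: "polynomial_nat (search_time j)"
proof (induction j)
  case 0
  show ?case
    unfolding search_time.simps test_time_def evaluate_time_def
    by (intro polynomial_nat_intros polynomial_nat_for)
next
  case (Suc j)
  then show ?case
    unfolding search_time.simps by (intro polynomial_nat_intros polynomial_nat_for)
qed

lemma polynomial_nat_iterate_time: "polynomial_nat (iterate_time q K m)"
proof (induction m)
  case 0
  show ?case
    unfolding iterate_time.simps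
    by (intro polynomial_nat_intros polynomial_nat_for polynomial_nat_search_time)
next
  case (Suc m)
  then show ?case
    unfolding iterate_time.simps by (intro polynomial_nat_intros polynomial_nat_for)
qed

text \<open>Puts the sum into the order in which the two loops of \<open>evaluate\<close> accumulate
  it.\<close>

lemma dispersion_double_sum:
  fixes S :: "nat set"
  assumes "S \<subseteq> {..<n}"
  shows "dispersion d S = (\<Sum>b<n. \<Sum>a<b. if a \<in> S \<and> b \<in> S then d a b else 0)"
proof -
  have "(\<Sum>b<n. \<Sum>a<b. if a \<in> S \<and> b \<in> S then d a b else 0)
      = (\<Sum>x\<in>(SIGMA b:{..<n}. {..<b}). if snd x \<in> S \<and> fst x \<in> S then d (snd x) (fst x) else 0)"
    by (subst sum.Sigma) (auto simp: case_prod_unfold)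
  also have "\<dots> = (\<Sum>x | x \<in> (SIGMA b:{..<n}. {..<b}) \<and> snd x \<in> S \<and> fst x \<in> S. d (snd x) (fst x))"
    by (intro sum.inter_filter[symmetric]) auto
  also have "\<dots> = (\<Sum>x | fst x \<in> S \<and> snd x \<in> S \<and> fst x < snd x. d (fst x) (snd x))"
    by (rule sum.reindex_bij_witness[of _ prod.swap prod.swap]) (use assms in auto)
  finally show ?thesis by (simp add: dispersion_def case_prod_unfold)
qed

lemma runs_evaluate:
  "runs P evaluate s (evaluate_time (elems P))
     (\<lambda>s'. keeps 2 s s' \<and> snd s' 0 0 = snd s 0 0 \<and>
       snd s' 0 1 = dispersion (dist_of P) (array_set P 1 s))"
proof -
  let ?S = "array_set P 1 s" and ?n = "elems P"
  define f where "f a b = (if a \<in> ?S \<and> b \<in> ?S then dist_of P a b else 0)" for a b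
  define K where "K x s' \<longleftrightarrow> keeps 2 s s' \<and> snd s' 0 0 = snd s 0 0 \<and> snd s' 0 1 = x" for x s'
  have outer: "runs P (for_loop 0 NSize (for_loop 1 (counter 0)
       (Cond (BAnd (NLess (NConst 0) (NArr 1 (counter 0))) (NLess (NConst 0) (NArr 1 (counter 1))))
         (RAssign 0 (NConst 1) (RAdd (RArr 0 (NConst 1)) (RDist (counter 1) (counter 0))))
         Skip))) s' (for_time ?n (for_time ?n 2)) (K (\<Sum>b<?n. \<Sum>a<b. f a b))" if "K 0 s'" for s'
  proof (rule runs_for[where I = "\<lambda>b. K (\<Sum>b'<b. \<Sum>a<b'. f a b')"])
    show "K (\<Sum>b'<0. \<Sum>a<b'. f a b') (nupdate 3 0 0 s')"
      using that by (simp add: K_def keeps_def nupdate_def)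
    fix b s1 assume b: "b < ?n" and K: "K (\<Sum>b'<b. \<Sum>a<b'. f a b') s1" and ctr: "fst s1 3 0 = b"
    let ?Q = "\<lambda>s'. fst s' 3 0 = b \<and> K (\<Sum>b'<Suc b. \<Sum>a<b'. f a b') (nupdate 3 0 (Suc b) s')"
    have "runs P (for_loop 1 (counter 0)
       (Cond (BAnd (NLess (NConst 0) (NArr 1 (counter 0))) (NLess (NConst 0) (NArr 1 (counter 1))))
         (RAssign 0 (NConst 1) (RAdd (RArr 0 (NConst 1)) (RDist (counter 1) (counter 0))))
         Skip)) s1 (for_time b 2) ?Q"
    \<comment> \<open>The rows before \<open>b\<close> are complete and row \<open>b\<close> is
      summed up to \<open>a\<close>. Counter 0 is part of the invariant because it bounds the inner
      loop.\<close>
    proof (rule runs_for[where I = "\<lambda>a s'. fst s' 3 0 = b \<and> K ((\<Sum>b'<b. \<Sum>a<b'. f a b') + (\<Sum>a'<a. f a' b)) s'"])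
      show "fst (nupdate 3 1 0 s1) 3 0 = b \<and> K ((\<Sum>b'<b. \<Sum>a<b'. f a b') + (\<Sum>a'<0. f a' b)) (nupdate 3 1 0 s1)"
        using K ctr by (simp add: K_def keeps_def nupdate_def)
      fix a s2 assume a: "a < b" and I: "fst s2 3 0 = b \<and> K ((\<Sum>b'<b. \<Sum>a<b'. f a b') + (\<Sum>a'<a. f a' b)) s2"
        and ctr2: "fst s2 3 1 = a"
      have arr: "fst s2 1 = fst s 1" using I by (simp add: K_def keeps_def)
      have mem: "0 < fst s2 1 i \<longleftrightarrow> i \<in> ?S" if "i < ?n" for i
        using that arr by (simp add: array_set_def)
      have "runs P (Cond (BAnd (NLess (NConst 0) (NArr 1 (counter 0))) (NLess (NConst 0) (NArr 1 (counter 1))))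
         (RAssign 0 (NConst 1) (RAdd (RArr 0 (NConst 1)) (RDist (counter 1) (counter 0)))) Skip) s2 (1 + 1)
         (\<lambda>s'. fst s' 3 1 = a \<and> fst (nupdate 3 1 (Suc a) s') 3 0 = b \<and>
           K ((\<Sum>b'<b. \<Sum>a<b'. f a b') + (\<Sum>a'<Suc a. f a' b)) (nupdate 3 1 (Suc a) s'))"
        by (rule runs_Cond; (rule runs_RAssign | rule runs_Skip))
          (use a b I ctr2 mem[of a] mem[of b] in
            \<open>auto simp: K_def f_def keeps_def nupdate_def rupdate_def\<close>)
      then show "runs P (Cond (BAnd (NLess (NConst 0) (NArr 1 (counter 0))) (NLess (NConst 0) (NArr 1 (counter 1))))
         (RAssign 0 (NConst 1) (RAdd (RArr 0 (NConst 1)) (RDist (counter 1) (counter 0)))) Skip) s2 2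
         (\<lambda>s'. fst s' 3 1 = a \<and> fst (nupdate 3 1 (Suc a) s') 3 0 = b \<and>
           K ((\<Sum>b'<b. \<Sum>a<b'. f a b') + (\<Sum>a'<Suc a. f a' b)) (nupdate 3 1 (Suc a) s'))"
        by (simp only: one_add_one)
    qed (auto simp: K_def keeps_def nupdate_def)
    then show "runs P (for_loop 1 (counter 0)
       (Cond (BAnd (NLess (NConst 0) (NArr 1 (counter 0))) (NLess (NConst 0) (NArr 1 (counter 1))))
         (RAssign 0 (NConst 1) (RAdd (RArr 0 (NConst 1)) (RDist (counter 1) (counter 0))))
         Skip)) s1 (for_time ?n 2) ?Q"
      by (rule runs_mono) (use b in \<open>simp_all add: for_time_mono\<close>)
  qed auto
  have total: "(\<Sum>b<?n. \<Sum>a<b. f a b) = dispersion (dist_of P) ?S"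
    unfolding f_def by (rule dispersion_double_sum[symmetric]) (auto simp: array_set_def)
  have "runs P evaluate s (1 + for_time ?n (for_time ?n 2)) (K (\<Sum>b<?n. \<Sum>a<b. f a b))"
    unfolding evaluate_def
  proof (rule runs_Seq[OF _ outer])
    show "runs P (RAssign 0 (NConst 1) (RConst 0)) s 1 (K 0)"
      by (rule runs_RAssign) (simp add: K_def keeps_def rupdate_def)
  qed
  then show ?thesis unfolding total K_def evaluate_time_def .
qed

lemma runs_copy:
  assumes "a \<noteq> b" "a \<noteq> 3" "b \<noteq> 3"
  shows "runs P (copy a b) s (for_time (elems P) 1)
    (\<lambda>s'. array_set P b s' = array_set P a s \<and> (\<forall>a'. a' \<noteq> b \<longrightarrow> a' \<noteq> 3 \<longrightarrow> fst s' a' = fst s a') \<and>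
      (\<forall>k\<ge>1. fst s' 3 k = fst s 3 k) \<and> snd s' = snd s)"
  unfolding copy_def
proof (rule runs_for[where I = "\<lambda>i s'. (\<forall>j<i. fst s' b j = fst s a j) \<and>
      (\<forall>a'. a' \<noteq> b \<longrightarrow> a' \<noteq> 3 \<longrightarrow> fst s' a' = fst s a') \<and>
      (\<forall>k\<ge>1. fst s' 3 k = fst s 3 k) \<and> snd s' = snd s"])
  fix i s1
  assume "i < elems P" "fst s1 3 0 = i" and
    "(\<forall>j<i. fst s1 b j = fst s a j) \<and> (\<forall>a'. a' \<noteq> b \<longrightarrow> a' \<noteq> 3 \<longrightarrow> fst s1 a' = fst s a') \<and>
      (\<forall>k\<ge>1. fst s1 3 k = fst s 3 k) \<and> snd s1 = snd s"
  then show "runs P (NAssign b (counter 0) (NArr a (counter 0))) s1 1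
    (\<lambda>s'. fst s' 3 0 = i \<and>
      (\<forall>j<Suc i. fst (nupdate 3 0 (Suc i) s') b j = fst s a j) \<and>
      (\<forall>a'. a' \<noteq> b \<longrightarrow> a' \<noteq> 3 \<longrightarrow> fst (nupdate 3 0 (Suc i) s') a' = fst s a') \<and>
      (\<forall>k\<ge>1. fst (nupdate 3 0 (Suc i) s') 3 k = fst s 3 k) \<and> snd (nupdate 3 0 (Suc i) s') = snd s)"
    using assms by (intro runs_NAssign) (auto simp: nupdate_def less_Suc_eq)
qed (use assms in \<open>auto simp: nupdate_def array_set_def\<close>)

section \<open>Correctness of the local search\<close>

locale search_instance = dispersion_instance "{..<n}" d I1 I2 for n :: nat and d I1 I2
begin

definition P :: input where
  "P = \<lparr>elems = n, dist_of = d, family1 = I1, family2 = I2\<rparr>"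

lemma P_simps [simp]: "elems P = n" "dist_of P = d" "family1 P = I1" "family2 P = I2"
  by (simp_all add: P_def)

abbreviation best :: "state \<Rightarrow> nat set" where
  "best \<equiv> array_set P 0"

abbreviation candidate :: "state \<Rightarrow> nat set" where
  "candidate \<equiv> array_set P 1"

abbreviation best_val :: "state \<Rightarrow> real" where
  "best_val s \<equiv> snd s 0 0"

definition consistent :: "state \<Rightarrow> bool" where
  "consistent s \<longleftrightarrow> best s \<in> feasible \<and> best_val s = dispersion d (best s)"

text \<open>The candidate is compared as a set: toggling twice restores membership, but not every
  stored value.\<close>

definition progress :: "nat \<Rightarrow> state \<Rightarrow> state \<Rightarrow> bool" where
  "progress j s s' \<longleftrightarrow> consistent s' \<and> candidate s' = candidate s \<and>
     (\<forall>k\<ge>j. fst s' 3 k = fst s 3 k) \<and> best_val s \<le> best_val s'"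

lemma runs_test:
  assumes cons: "consistent s"
  shows "runs P test s (test_time n)
    (\<lambda>s'. progress 2 s s' \<and> (candidate s \<in> feasible \<longrightarrow> dispersion d (candidate s) \<le> best_val s'))"
    (is "runs _ _ _ _ ?Q")
  unfolding test_def test_time_def
proof (rule runs_Cond)
  assume "bval P (BAnd (Indep1 1) (Indep2 1)) s"
  then have feas: "candidate s \<in> feasible" by simp
  let ?R = "\<lambda>s'. keeps 2 s s' \<and> best_val s' = best_val s \<and> snd s' 0 1 = dispersion d (candidate s)"
  show "runs P (Seq evaluate (Cond (RLess (RArr 0 (NConst 0)) (RArr 0 (NConst 1)))
         (Seq (RAssign 0 (NConst 0) (RArr 0 (NConst 1))) (copy 1 0)) Skip)) s
         (evaluate_time n + ((1 + for_time n 1) + 1)) ?Q"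
  proof (rule runs_Seq)
    show "runs P evaluate s (evaluate_time n) ?R"
      using runs_evaluate[of P s] by simp
    fix s1 assume s1: "?R s1"
    then have cand: "candidate s1 = candidate s" and best: "best s1 = best s"
      by (simp_all add: keeps_def array_set_def)
    show "runs P (Cond (RLess (RArr 0 (NConst 0)) (RArr 0 (NConst 1)))
         (Seq (RAssign 0 (NConst 0) (RArr 0 (NConst 1))) (copy 1 0)) Skip) s1 ((1 + for_time n 1) + 1) ?Q"
    proof (rule runs_Cond)
      assume "bval P (RLess (RArr 0 (NConst 0)) (RArr 0 (NConst 1))) s1"
      then have less: "best_val s < dispersion d (candidate s)" using s1 by simp
      show "runs P (Seq (RAssign 0 (NConst 0) (RArr 0 (NConst 1))) (copy 1 0)) s1 (1 + for_time n 1) ?Q"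
      proof (rule runs_Seq)
        show "runs P (RAssign 0 (NConst 0) (RArr 0 (NConst 1))) s1 1
            (\<lambda>s'. fst s' = fst s1 \<and> best_val s' = dispersion d (candidate s))"
          by (rule runs_RAssign) (use s1 in \<open>simp add: rupdate_def\<close>)
        fix s2 assume s2: "fst s2 = fst s1 \<and> best_val s2 = dispersion d (candidate s)"
        then have "candidate s2 = candidate s" using cand by (simp add: array_set_def)
        then show "runs P (copy 1 0) s2 (for_time n 1) ?Q"
          using runs_copy[of 1 0 P s2] s1 s2 less feas
          by (auto elim!: runs_mono simp: progress_def consistent_def keeps_def array_set_def)
      qed
    next
      assume "\<not> bval P (RLess (RArr 0 (NConst 0)) (RArr 0 (NConst 1))) s1"
      then have "dispersion d (candidate s) \<le> best_val s" using s1 by simp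
      then have "?Q s1"
        using s1 cand best cons by (simp add: progress_def consistent_def keeps_def)
      then have "runs P Skip s1 1 ?Q" by (rule runs_Skip)
      then show "runs P Skip s1 (1 + for_time n 1) ?Q" by (rule runs_mono) auto
    qed
  qed
next
  assume "\<not> bval P (BAnd (Indep1 1) (Indep2 1)) s"
  then have "?Q s" using cons by (auto simp: progress_def)
  then have "runs P Skip s 1 ?Q" by (rule runs_Skip)
  then show "runs P Skip s (evaluate_time n + ((1 + for_time n 1) + 1)) ?Q"
    by (rule runs_mono) auto
qed

text \<open>The intersection makes \<open>flip n\<close> the identity, matching the toggled cell
  outside the ground set.\<close>

definition flip :: "nat \<Rightarrow> nat set \<Rightarrow> nat set" where
  "flip i S = sym_diff S ({i} \<inter> {..<n})"

lemma flip_flip: "flip i (flip i S) = S"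
  by (auto simp: flip_def)

lemma runs_toggle:
  assumes "fst s 3 k = i"
  shows "runs P (toggle k) s 1
    (\<lambda>s'. candidate s' = flip i (candidate s) \<and> best s' = best s \<and> fst s' 3 = fst s 3 \<and> snd s' = snd s)"
  unfolding toggle_def
  by (rule runs_NAssign) (use assms in \<open>auto simp: nupdate_def array_set_def flip_def\<close>)

text \<open>If \<open>T\<close> differs from the candidate \<open>S\<close>, flipping any element in
  which they differ brings \<open>S\<close> one step closer to \<open>T\<close>, and the inner
  search finds \<open>T\<close> from there. The case \<open>T = S\<close> is reached through the
  index \<open>n\<close>.\<close>

lemma runs_search:
  assumes "consistent s"
  shows "runs P (search j) s (search_time j n)
    (\<lambda>s'. progress (j + 2) s s' \<and>
      (\<forall>T\<in>feasible. card (sym_diff (candidate s) T) \<le> j \<longrightarrow> dispersion d T \<le> best_val s'))"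
  using assms
proof (induction j arbitrary: s)
  case 0
  have eq: "T = candidate s" if "T \<in> feasible" "card (sym_diff (candidate s) T) \<le> 0" for T
  proof -
    have "finite (sym_diff (candidate s) T)"
      using feasible_finite[OF that(1)] by (simp add: array_set_def)
    then show ?thesis using that(2) by auto
  qed
  have "runs P test s (test_time n)
    (\<lambda>s'. progress 2 s s' \<and> (candidate s \<in> feasible \<longrightarrow> dispersion d (candidate s) \<le> best_val s'))"
    using 0 by (rule runs_test)
  then show ?case
    unfolding search.simps search_time.simps
    by (rule runs_mono) (use eq in \<open>auto simp: numeral_2_eq_2\<close>)
next
  case (Suc j)
  define S where "S = candidate s"
  define covered where "covered i s' \<longleftrightarrow>
    (\<forall>i'<i. \<forall>T\<in>feasible. card (sym_diff (flip i' S) T) \<le> j \<longrightarrow> dispersion d T \<le> best_val s')" for i s'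
  let ?k = "j + 2"
  show ?case
    unfolding search.simps search_time.simps
  proof (rule runs_for[where I = "\<lambda>i s'. progress (Suc j + 2) s s' \<and> covered i s'"])
    show "progress (Suc j + 2) s (nupdate 3 ?k 0 s) \<and> covered 0 (nupdate 3 ?k 0 s)"
      using Suc.prems by (auto simp: progress_def covered_def consistent_def array_set_def nupdate_def)
    show "nval P (NAdd NSize (NConst 1)) s' = n + 1" for s' by simp
  next
    fix i s1 assume i: "i < n + 1" and I: "progress (Suc j + 2) s s1 \<and> covered i s1" and ctr: "fst s1 3 ?k = i"
    have cand1: "candidate s1 = S" and cons1: "consistent s1" using I by (auto simp: progress_def S_def)
    let ?Q = "\<lambda>s'. fst s' 3 ?k = i \<and> progress (Suc j + 2) s (nupdate 3 ?k (Suc i) s') \<and>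
      covered (Suc i) (nupdate 3 ?k (Suc i) s')"
    show "runs P (Seq (toggle ?k) (Seq (search j) (toggle ?k))) s1 (1 + (search_time j n + 1)) ?Q"
    proof (rule runs_Seq[OF runs_toggle[OF ctr]])
      fix s2
      assume s2: "candidate s2 = flip i (candidate s1) \<and> best s2 = best s1 \<and> fst s2 3 = fst s1 3 \<and> snd s2 = snd s1"
      have cons2: "consistent s2" using s2 cons1 by (simp add: consistent_def)
      show "runs P (Seq (search j) (toggle ?k)) s2 (search_time j n + 1) ?Q"
      proof (rule runs_Seq[OF Suc.IH[OF cons2]])
        fix s3
        assume s3: "progress (j + 2) s2 s3 \<and>
          (\<forall>T\<in>feasible. card (sym_diff (candidate s2) T) \<le> j \<longrightarrow> dispersion d T \<le> best_val s3)"
        have ctr3: "fst s3 3 ?k = i" using s3 s2 ctr by (simp add: progress_def)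
        have val3: "best_val s1 \<le> best_val s3" using s3 s2 by (simp add: progress_def)
        have cov: "covered (Suc i) s3"
          unfolding covered_def
        proof (intro allI impI ballI)
          fix i' T assume *: "i' < Suc i" "T \<in> feasible" "card (sym_diff (flip i' S) T) \<le> j"
          show "dispersion d T \<le> best_val s3"
          proof (cases "i' = i")
            case True
            then show ?thesis using s3 s2 * cand1 by simp
          next
            case False
            then have "i' < i" using * by simp
            then have "dispersion d T \<le> best_val s1" using I * unfolding covered_def by blast
            then show ?thesis using val3 by linarith
          qed
        qed
        show "runs P (toggle ?k) s3 1 ?Q"
        proof (rule runs_mono[OF runs_toggle[OF ctr3] order_refl])
          fix s4
          assume s4: "candidate s4 = flip i (candidate s3) \<and> best s4 = best s3 \<and> fst s4 3 = fst s3 3 \<and> snd s4 = snd s3"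
          have "candidate s4 = S"
            using s4 s3 s2 cand1 by (simp add: progress_def flip_flip)
          moreover have "consistent s4" using s4 s3 by (simp add: progress_def consistent_def)
          moreover have "fst s4 3 k = fst s 3 k" if "Suc j + 2 \<le> k" for k
            using that s4 s3 s2 I by (simp add: progress_def)
          moreover have "best_val s \<le> best_val s4" using I val3 s4 by (simp add: progress_def)
          moreover have "covered (Suc i) s4" using cov s4 by (simp add: covered_def)
          ultimately show "?Q s4"
            using ctr3 s4
            by (simp add: progress_def consistent_def covered_def S_def array_set_def nupdate_def)
        qed
      qed
    qed
  next
    fix s' assume I: "progress (Suc j + 2) s s' \<and> covered (n + 1) s'"
    then have cov: "dispersion d T \<le> best_val s'"
      if "i < n + 1" "T \<in> feasible" "card (sym_diff (flip i S) T) \<le> j" for i T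
      using that unfolding covered_def by blast
    have "dispersion d T \<le> best_val s'" if T: "T \<in> feasible" "card (sym_diff S T) \<le> Suc j" for T
    proof (cases "sym_diff S T = {}")
      case True
      then have "card (sym_diff (flip n S) T) \<le> j" by (auto simp: flip_def)
      then show ?thesis using T(1) by (intro cov[of n]) auto
    next
      case False
      then obtain i where i: "i \<in> sym_diff S T" by blast
      have "S \<subseteq> {..<n}" "T \<subseteq> {..<n}" using feasible_subset[OF T(1)] by (auto simp: S_def array_set_def)
      then have "i < n" using i by auto
      then have "sym_diff (flip i S) T = sym_diff S T - {i}" using i by (auto simp: flip_def)
      moreover have "finite (sym_diff S T)"
        using feasible_finite[OF T(1)] by (simp add: S_def array_set_def)
      ultimately have "card (sym_diff (flip i S) T) \<le> j" using i T(2) by (simp add: card_Diff_singleton)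
      then show ?thesis using T(1) \<open>i < n\<close> by (intro cov[of i]) auto
    qed
    then show "progress (Suc j + 2) s s' \<and>
      (\<forall>T\<in>feasible. card (sym_diff (candidate s) T) \<le> Suc j \<longrightarrow> dispersion d T \<le> best_val s')"
      using I by (simp add: S_def)
  qed
qed

text \<open>One search is at least as good as the set from \<open>local_improvement\<close>, hence
  shrinks the gap by the factor \<open>\<rho>\<close>; loops multiply the exponents. The gap is cut
  off at 0, beyond which no gain is promised. Using \<open>n + K\<close> for \<open>n\<close> keeps
  the denominator at least 1 even on the empty ground set.\<close>

lemma runs_iterate:
  fixes p :: nat
  assumes B: "B \<in> feasible" and \<delta>: "9 / p \<le> \<delta>" "\<delta> < 1" and p: "0 < p" and K: "0 < K"
    and cons: "consistent s"
  defines "gap \<equiv> \<lambda>s. max 0 ((1 - \<delta>) * dispersion d B - best_val s)"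
    and "q \<equiv> 9 * p * (p + 1)" and "\<rho> \<equiv> 1 - 1 / (2 * real (n + K) ^ 3)"
  shows "runs P (iterate q K m) s (iterate_time q K m n)
    (\<lambda>s'. consistent s' \<and> (\<forall>k\<ge>q + 2 + m. fst s' 3 k = fst s 3 k) \<and> gap s' \<le> \<rho> ^ ((n + K) ^ m) * gap s)"
  using cons
proof (induction m arbitrary: s)
  case 0
  show ?case
    unfolding iterate.simps iterate_time.simps
  proof (rule runs_Seq)
    show "runs P (copy 0 1) s (for_time n 1)
      (\<lambda>s'. consistent s' \<and> candidate s' = best s \<and> (\<forall>k\<ge>1. fst s' 3 k = fst s 3 k) \<and> best_val s' = best_val s)"
      using runs_copy[of 0 1 P s] 0
      by (auto elim!: runs_mono simp: consistent_def array_set_def)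
    fix s1
    assume s1: "consistent s1 \<and> candidate s1 = best s \<and> (\<forall>k\<ge>1. fst s1 3 k = fst s 3 k) \<and> best_val s1 = best_val s"
    show "runs P (search q) s1 (search_time q n)
      (\<lambda>s'. consistent s' \<and> (\<forall>k\<ge>q + 2 + 0. fst s' 3 k = fst s 3 k) \<and> gap s' \<le> \<rho> ^ ((n + K) ^ 0) * gap s)"
    proof (rule runs_mono[OF runs_search order_refl])
      show "consistent s1" using s1 by simp
      fix s2
      assume s2: "progress (q + 2) s1 s2 \<and>
        (\<forall>T\<in>feasible. card (sym_diff (candidate s1) T) \<le> q \<longrightarrow> dispersion d T \<le> best_val s2)"
      have A: "best s \<in> feasible" "best_val s = dispersion d (best s)" using 0 by (auto simp: consistent_def)
      obtain C where C: "C \<in> feasible" "card (sym_diff (best s) C) \<le> q"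
        "dispersion d (best s) \<le> dispersion d C"
        "(1 - \<delta>) * dispersion d B - dispersion d (best s)
          \<le> 2 * real n ^ 3 * (dispersion d C - dispersion d (best s))"
        using local_improvement[OF A(1) B \<delta> p] unfolding q_def by (auto simp only: card_lessThan)
      have "dispersion d C \<le> best_val s2" using s1 s2 C(1,2) by simp
      then have inc: "dispersion d C - dispersion d (best s) \<le> best_val s2 - best_val s" using A by simp
      define g N where "g = (1 - \<delta>) * dispersion d B - best_val s" and "N = 2 * real (n + K) ^ 3"
      have N: "1 \<le> N"
        using K one_le_power[of "real (n + K)" 3] unfolding N_def by linarith
      have "g \<le> 2 * real n ^ 3 * (dispersion d C - dispersion d (best s))" using C(4) A by (simp add: g_def)
      also have "\<dots> \<le> N * (dispersion d C - dispersion d (best s))"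
        unfolding N_def using C(3) by (intro mult_right_mono mult_left_mono power_mono) auto
      also have "\<dots> \<le> N * (best_val s2 - best_val s)" using inc N by (intro mult_left_mono) auto
      finally have "g / N \<le> best_val s2 - best_val s" using N by (simp add: field_simps)
      then have "(1 - \<delta>) * dispersion d B - best_val s2 \<le> (1 - 1 / N) * g"
        by (simp add: g_def left_diff_distrib)
      also have "\<dots> \<le> (1 - 1 / N) * max 0 g" using N by (intro mult_left_mono) auto
      finally have "(1 - \<delta>) * dispersion d B - best_val s2 \<le> (1 - 1 / N) * max 0 g" .
      moreover have "0 \<le> (1 - 1 / N) * max 0 g" using N by (intro mult_nonneg_nonneg) auto
      ultimately have "gap s2 \<le> (1 - 1 / N) * max 0 g" unfolding gap_def by simp
      then have "gap s2 \<le> \<rho> * gap s" by (simp only: \<rho>_def gap_def g_def N_def)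
      moreover have "fst s2 3 k = fst s 3 k" if "q + 2 \<le> k" for k
        using that s1 s2 by (simp add: progress_def)
      ultimately show "consistent s2 \<and> (\<forall>k\<ge>q + 2 + 0. fst s2 3 k = fst s 3 k) \<and> gap s2 \<le> \<rho> ^ ((n + K) ^ 0) * gap s"
        using s2 by (simp add: progress_def)
    qed
  qed
next
  case (Suc m)
  have \<rho>0: "0 \<le> \<rho>"
  proof -
    have "1 \<le> 2 * real (n + K) ^ 3" using K one_le_power[of "real (n + K)" 3] by linarith
    moreover have "0 \<le> 1 - 1 / y" if "1 \<le> y" for y :: real using that by simp
    ultimately show ?thesis unfolding \<rho>_def by blast
  qed
  let ?k = "q + 2 + m" and ?M = "(n + K) ^ m"
  show ?case
    unfolding iterate.simps iterate_time.simps
  \<comment> \<open>After \<open>i\<close> passes of the outer loop, \<open>i * ?M\<close> searches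
    have taken place.\<close>
  proof (rule runs_for[where I = "\<lambda>i s'. consistent s' \<and> (\<forall>k\<ge>q + 2 + Suc m. fst s' 3 k = fst s 3 k) \<and>
      gap s' \<le> \<rho> ^ (i * ?M) * gap s"])
    fix i s1
    assume i: "i < n + K" and ctr: "fst s1 3 ?k = i"
      and I: "consistent s1 \<and> (\<forall>k\<ge>q + 2 + Suc m. fst s1 3 k = fst s 3 k) \<and> gap s1 \<le> \<rho> ^ (i * ?M) * gap s"
    show "runs P (iterate q K m) s1 (iterate_time q K m n) (\<lambda>s'. fst s' 3 ?k = i \<and>
      consistent (nupdate 3 ?k (Suc i) s') \<and>
      (\<forall>k\<ge>q + 2 + Suc m. fst (nupdate 3 ?k (Suc i) s') 3 k = fst s 3 k) \<and>
      gap (nupdate 3 ?k (Suc i) s') \<le> \<rho> ^ (Suc i * ?M) * gap s)"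
    proof (rule runs_mono[OF Suc.IH order_refl])
      show "consistent s1" using I by simp
      fix s2
      assume s2: "consistent s2 \<and> (\<forall>k\<ge>q + 2 + m. fst s2 3 k = fst s1 3 k) \<and> gap s2 \<le> \<rho> ^ ?M * gap s1"
      then have "gap s2 \<le> \<rho> ^ ?M * gap s1" by blast
      also have "\<dots> \<le> \<rho> ^ ?M * (\<rho> ^ (i * ?M) * gap s)"
        using I \<rho>0 by (intro mult_left_mono) auto
      also have "\<dots> = \<rho> ^ (Suc i * ?M) * gap s" by (simp add: power_add)
      finally have "gap s2 \<le> \<rho> ^ (Suc i * ?M) * gap s" .
      then show "fst s2 3 ?k = i \<and> consistent (nupdate 3 ?k (Suc i) s2) \<and>
        (\<forall>k\<ge>q + 2 + Suc m. fst (nupdate 3 ?k (Suc i) s2) 3 k = fst s 3 k) \<and>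
        gap (nupdate 3 ?k (Suc i) s2) \<le> \<rho> ^ (Suc i * ?M) * gap s"
        using s2 I ctr by (simp add: gap_def consistent_def array_set_def nupdate_def)
    qed
  qed (use Suc.prems in \<open>auto simp: gap_def consistent_def array_set_def nupdate_def mult.commute\<close>)
qed

end

section \<open>Convergence and the approximation guarantee\<close>

text \<open>With \<open>x = n + K\<close>, the estimate \<open>1 - y \<le> exp (- y)\<close> leaves
  \<open>exp (- (x / 2))\<close>, and \<open>exp (x / 2) \<ge> x / 2 \<ge> 1 / \<delta>\<close>. The
  summand \<open>K\<close> secures this for small \<open>n\<close>.\<close>

lemma decay_bound:
  fixes K n :: nat and \<delta> :: real
  assumes \<delta>: "0 < \<delta>" and K: "2 / \<delta> \<le> K"
  shows "(1 - 1 / (2 * real (n + K) ^ 3)) ^ ((n + K) ^ 4) \<le> \<delta>"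
proof -
  define x where "x = real (n + K)"
  have "0 < 2 / \<delta>" using \<delta> by simp
  then have K0: "0 < real K" using K by linarith
  then have x: "1 \<le> x" "real K \<le> x" by (auto simp: x_def)
  have "1 - 1 / (2 * x ^ 3) \<le> exp (- (1 / (2 * x ^ 3)))"
    using exp_ge_add_one_self[of "- (1 / (2 * x ^ 3))"] by simp
  moreover have "1 \<le> 2 * x ^ 3" using one_le_power[OF x(1), of 3] by linarith
  moreover have "0 \<le> 1 - 1 / y" if "1 \<le> y" for y :: real using that by simp
  ultimately have "(1 - 1 / (2 * x ^ 3)) ^ ((n + K) ^ 4) \<le> exp (- (1 / (2 * x ^ 3))) ^ ((n + K) ^ 4)"
    by (intro power_mono) blast+
  also have "\<dots> = exp (real ((n + K) ^ 4) * - (1 / (2 * x ^ 3)))"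
    by (rule exp_of_nat_mult[symmetric])
  also have "real ((n + K) ^ 4) * - (1 / (2 * x ^ 3)) = - (x / 2)"
  proof -
    have "real ((n + K) ^ 4) = x ^ 4" by (simp add: x_def)
    then show ?thesis using x(1) by (simp add: eval_nat_numeral)
  qed
  also have "exp (- (x / 2)) \<le> \<delta>"
  proof -
    have "2 / \<delta> \<le> x" using K x(2) by linarith
    then have "1 / \<delta> \<le> x / 2" by simp
    also have "\<dots> \<le> exp (x / 2)" using exp_ge_add_one_self[of "x / 2"] by linarith
    finally show ?thesis using \<delta> by (simp add: exp_minus field_simps)
  qed
  finally show ?thesis by (simp add: x_def)
qed

theorem theorem2:
  fixes \<epsilon> :: real
  assumes "\<epsilon> > 0"
  shows "\<exists>(c :: com) (p :: nat poly).
    \<forall>(n :: nat) (d :: nat \<Rightarrow> nat \<Rightarrow> real) (\<I>\<^sub>1 :: nat set set) (\<I>\<^sub>2 :: nat set set).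
      distance_function {..<n} d \<and> negative_type {..<n} d \<and>
      matroid {..<n} \<I>\<^sub>1 \<and> matroid {..<n} \<I>\<^sub>2 \<longrightarrow>
      (\<exists>A. returns_within \<lparr>elems = n, dist_of = d, family1 = \<I>\<^sub>1, family2 = \<I>\<^sub>2\<rparr> c (poly p n) A \<and>
           A \<in> \<I>\<^sub>1 \<inter> \<I>\<^sub>2 \<and>
           dispersion d A \<ge> (1 - \<epsilon>) * Max {dispersion d S | S. S \<in> \<I>\<^sub>1 \<inter> \<I>\<^sub>2})"
proof -
  \<comment> \<open>One \<open>\<delta>\<close> is spent on the quality that local search converges
    to, the other on stopping after finitely many rounds. The minimum with 1 ensures
    \<open>\<delta> < 1\<close>.\<close>
  define \<delta> where "\<delta> = min \<epsilon> 1 / 2"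
  have \<delta>: "0 < \<delta>" "\<delta> < 1" "2 * \<delta> \<le> \<epsilon>" using assms by (auto simp: \<delta>_def min_def)
  obtain p :: nat where p: "9 / \<delta> \<le> p" using real_arch_simple by blast
  obtain K :: nat where K: "2 / \<delta> \<le> K" using real_arch_simple by blast
  have "0 < 9 / \<delta>" "0 < 2 / \<delta>" using \<delta> by auto
  then have p0: "0 < p" and K0: "0 < K" using p K by (auto intro: Nat.gr0I)
  have p\<delta>: "9 / p \<le> \<delta>" using p p0 \<delta> by (simp add: field_simps)
  define q where "q = 9 * p * (p + 1)"
  \<comment> \<open>Four loops give \<open>(n + K) ^ 4\<close> rounds, one power more than the
    \<open>2 * (n + K) ^ 3\<close> in the decay rate.\<close>
  obtain t :: "nat poly" where t: "\<And>n. iterate_time q K 4 n = poly t n"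
    using polynomial_nat_iterate_time[of q K 4] by (auto simp: polynomial_nat_def)
  show ?thesis
  proof (intro exI[of _ "iterate q K 4"] exI[of _ t] allI impI)
    fix n :: nat and d :: "nat \<Rightarrow> nat \<Rightarrow> real" and I1 I2 :: "nat set set"
    assume a: "distance_function {..<n} d \<and> negative_type {..<n} d \<and> matroid {..<n} I1 \<and> matroid {..<n} I2"
    then interpret search_instance n d I1 I2
      by (simp add: search_instance_def dispersion_instance_def negative_type_space_def)
    let ?V = "{dispersion d S | S. S \<in> feasible}"
    have "?V = dispersion d ` feasible" by auto
    moreover have "feasible \<subseteq> Pow {..<n}" using feasible_subset by blast
    ultimately have "finite ?V" using finite_subset by (metis finite_Pow_iff finite_imageI finite_lessThan)
    moreover have empty: "{} \<in> feasible" using M1.empty_indep M2.empty_indep by blast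
    ultimately have "Max ?V \<in> ?V" by (intro Max_in) auto
    then obtain B where B: "B \<in> feasible" "Max ?V = dispersion d B" by auto
    have B0: "0 \<le> dispersion d B" using feasible_subset[OF B(1)] by (rule dispersion_nonneg)
    \<comment> \<open>The zero state encodes the empty set, which is feasible and has the stored
      dispersion 0.\<close>
    have init: "consistent initial_state" "best_val initial_state = 0"
      using empty by (auto simp: consistent_def initial_state_def array_set_def dispersion_def)
    obtain u s where s: "exec P (iterate q K 4) initial_state u s" "u \<le> iterate_time q K 4 n" "consistent s"
      "max 0 ((1 - \<delta>) * dispersion d B - best_val s)
        \<le> (1 - 1 / (2 * real (n + K) ^ 3)) ^ ((n + K) ^ 4) * max 0 ((1 - \<delta>) * dispersion d B)"
      using runs_iterate[OF B(1) p\<delta> \<delta>(2) p0 K0 init(1), of 4] init(2) unfolding runs_def q_def by auto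
    have "max 0 ((1 - \<delta>) * dispersion d B) \<le> dispersion d B"
      using B0 \<delta> by (simp add: mult_left_le_one_le)
    then have "(1 - 1 / (2 * real (n + K) ^ 3)) ^ ((n + K) ^ 4) * max 0 ((1 - \<delta>) * dispersion d B)
        \<le> \<delta> * dispersion d B"
      using decay_bound[OF \<delta>(1) K] \<delta> by (intro mult_mono) auto
    then have "(1 - \<delta>) * dispersion d B - best_val s \<le> \<delta> * dispersion d B" using s(4) by linarith
    then have "(1 - 2 * \<delta>) * dispersion d B \<le> best_val s" by (simp add: algebra_simps)
    moreover have "(1 - \<epsilon>) * dispersion d B \<le> (1 - 2 * \<delta>) * dispersion d B"
      using \<delta> B0 by (intro mult_right_mono) auto
    ultimately have "(1 - \<epsilon>) * Max ?V \<le> dispersion d (best s)"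
      using s(3) B(2) by (simp add: consistent_def)
    moreover have "returns_within P (iterate q K 4) (poly t n) (best s)"
      unfolding returns_within_def using s(1,2) t by (intro exI[of _ u] exI[of _ s]) simp
    ultimately show "\<exists>A. returns_within \<lparr>elems = n, dist_of = d, family1 = I1, family2 = I2\<rparr> (iterate q K 4) (poly t n) A \<and>
        A \<in> I1 \<inter> I2 \<and> dispersion d A \<ge> (1 - \<epsilon>) * Max {dispersion d S | S. S \<in> I1 \<inter> I2}"
      using s(3) unfolding P_def consistent_def by blast
  qed
qed

end
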